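(* Consider a structured system $(\bar A,\bar B,\bar C)$ and a feedback cost matrix $P$ given as input to the Dynamic Programming Algorithm and the Two-Stage Algorithm (both described in the context). Let the directed acyclic graph (DAG) of strongly connected components (SCCs) of the state digraph $\mathcal D(\bar A)$ be a line graph, and let $p^\star$ denote the optimal cost of the minimum cost feedback selection problem. Then: (i) if the state bipartite graph $\mathcal B(\bar A)$ has a perfect matching, then the output $\bar K^a$ of the Dynamic Programming Algorithm is an optimal solution to the minimum cost feedback selection problem, i.e. $P(\bar K^a)=p^\star$; (ii) if the state bipartite graph $\mathcal B(\bar A)$ does not have a perfect matching, then the output $\bar K^A$ of the Two-Stage Algorithm is a $2$-optimal solution to the minimum cost feedback selection problem, i.e. $P(\bar K^A)\le 2\,p^\star$.
   Context: A structured system is a triple $(\bar A,\bar B,\bar C)$ of matrices with entries in $\{0,\star\}$, where $\bar A$ is $n\times n$, $\bar B$ is $n\times m$ and $\bar C$ is $p\times n$, with states $x_1,\dots,x_n$, inputs $u_1,\dots,u_m$ and outputs $y_1,\dots,y_p$. A numerical realization is a triple of real matrices $(A,B,C)$ of the same sizes with zeros wherever $\bar A,\bar B,\bar C$ (respectively) have zeros. For $\bar K\in\{0,\star\}^{m\times p}$ let $[K]=\{K\in\mathbb R^{m\times p}:K_{ij}=0\text{ if }\bar K_{ij}=0\}$. The closed-loop system $(\bar A,\bar B,\bar C,\bar K)$ has no structurally fixed modes (SFMs) if there is a numerical realization $(A,B,C)$ with $\bigcap_{K\in[K]}\sigma(A+BKC)=\emptyset$, where $\sigma(T)$ is the set of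 eigenvalues of $T$. Let $\mathcal K_s=\{\bar K\in\{0,\star\}^{m\times p}:(\bar A,\bar B,\bar C,\bar K)\text{ has no SFMs}\}$. The feedback cost matrix is $P\in\mathbb R^{m\times p}$, where $P_{ij}$ is the cost of feeding output $y_j$ to input $u_i$; forbidden connections are modelled by an infinite cost. Put $P(\bar K)=\sum_{(i,j):\bar K_{ij}=\star}P_{ij}$. The minimum cost feedback selection problem is to find $\bar K^\star\in\arg\min_{\bar K\in\mathcal K_s}P(\bar K)$; its optimal cost is $p^\star=P(\bar K^\star)$. It is assumed that $\mathcal K_s$ is non-empty; specifically, the all-$\star$ matrix lies in $\mathcal K_s$. Graphs. The state digraph $\mathcal D(\bar A)$ has vertices $x_1,\dots,x_n$ and an edge $(x_j,x_i)$ iff $\bar A_{ij}=\star$. Its DAG of SCCs has the SCCs as nodes, with an edge from one SCC to another iff $\mathcal D(\bar A)$ has an edge from a state of the first to a state of the second. It is a line graph if it is a directed elementary path $\mathcal C_1\to\mathcal C_2\to\dots\to\mathcal C_\ell$ from a root vertex to a tip vertex; the SCCs are ordered in this way. The state bipartite graph $\mathcal B(\bar A)$ has vertex classes $\{x'_1,\dots,x'_n\}$ and $\{x_1,\dots,x_n\}$ and an edge $(x'_i,x_j)$ iff $\bar A_{ij}=\star$. A matching is a set of edges no two of which share an end point; in a bipartite graph with vertex classes of equal size it is perfect if its size equals that of a vertex class. Dynamic Programming Algorithm. For $k=1,\dots,\ell$ let $U_k=\{u_i:\bar B_{ri}=\star\text{ for some }x_r\in\mathcal C_k\}$, $Y_k=\{y_j:\bar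 C_{jr}=\star\text{ for some }x_r\in\mathcal C_k\}$, $\mathcal U_k=\bigcup_{i=1}^kU_i$, $\mathcal Y_k=\bigcup_{i=k}^{\ell}Y_i$, and $A_k=\{(y_j,u_i):y_j\in\mathcal Y_k,\ u_i\in\mathcal U_k\}$. For $(y_j,u_i)\in A_k$ let $t_k(i)=\min\{q:u_i\in\mathcal U_q\}$. Set $W([0])=0$, $\mathcal S_0=\emptyset$. For $k=1,\dots,\ell$ in order, set $W([k])=\min_{(y_j,u_i)\in A_k}\{P_{ij}+W([t_k(i)-1])\}$; if the minimum is attained at $(y_w,u_v)$, set $\mathcal S_k=\{(y_w,u_v)\}\cup\mathcal S_{t_k(v)-1}$. Output $\bar K^a$ with $\bar K^a_{ij}=\star$ iff $(y_j,u_i)\in\mathcal S_\ell$. Two-Stage Algorithm. First compute $\bar K^a$ by the Dynamic Programming Algorithm. Next, form the bipartite graph $\mathcal B(\bar A,\bar B,\bar C,\bar K)$ with $\bar K$ the all-$\star$ matrix: its vertex classes are $\{x'_i\}_{i\le n}\cup\{u'_i\}_{i\le m}\cup\{y'_j\}_{j\le p}$ and $\{x_i\}_{i\le n}\cup\{u_i\}_{i\le m}\cup\{y_j\}_{j\le p}$, with edges $(x'_i,x_j)$ iff $\bar A_{ij}=\star$; $(x'_i,u_j)$ iff $\bar B_{ij}=\star$; $(y'_j,x_i)$ iff $\bar C_{ji}=\star$; $(u'_i,y_j)$ iff $\bar K_{ij}=\star$; and all $(u'_i,u_i)$ and $(y'_j,y_j)$. Give edge $(u'_i,y_j)$ cost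 $P_{ij}$ and every other edge cost $0$. Let $M^\star$ be a minimum cost perfect matching, and $\bar K^b$ the matrix with $\bar K^b_{ij}=\star$ iff $(u'_i,y_j)\in M^\star$. Output $\bar K^A$ with $\bar K^A_{ij}=\star$ iff $\bar K^a_{ij}=\star$ or $\bar K^b_{ij}=\star$.
   Formalization: The feedback costs P_ij are assumed non-negative (infinite costs allowed); with negative costs the claim fails, e.g. one state, one input, two outputs, all entries ⋆ and P=(-1,-1): p*=-2 but the Dynamic Programming Algorithm gives cost -1. *)

theory Defs
  imports "Graph_Theory.Digraph_Component" "HOL-Analysis.Analysis"
begin

section \<open>Structured systems and structurally fixed modes\<close>

text \<open>
  A structured matrix is a Boolean matrix in which \<open>True\<close> stands for the free entry (star)
  and \<open>False\<close> for the fixed zero. As usual \<open>'a ^ 'c ^ 'r\<close> has rows indexed by \<open>'r\<close> and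
  columns indexed by \<open>'c\<close>; states, inputs and outputs are indexed by \<open>'n\<close>, \<open>'m\<close> and \<open>'p\<close>.
\<close>

definition realizations :: "bool ^ 'c ^ 'r \<Rightarrow> (real ^ 'c ^ 'r) set" where
  "realizations S = {X. \<forall>i j. \<not> S $ i $ j \<longrightarrow> X $ i $ j = 0}"

definition all_star :: "bool ^ 'c ^ 'r" where
  "all_star = (\<chi> i j. True)"

text \<open>The eigenvalues of a real matrix are taken over the complex numbers.\<close>

definition eigenvalues :: "real ^ 'n ^ 'n \<Rightarrow> complex set" where
  "eigenvalues T =
     {z. \<exists>v :: complex ^ 'n. v \<noteq> 0 \<and> map_matrix complex_of_real T *v v = z *s v}"

definition no_sfms ::
    "bool ^ 'n ^ 'n \<Rightarrow> bool ^ 'm ^ 'n \<Rightarrow> bool ^ 'n ^ 'p \<Rightarrow> bool ^ 'p ^ 'm \<Rightarrow> bool" where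
  "no_sfms Abar Bbar Cbar Kbar \<longleftrightarrow>
     (\<exists>A \<in> realizations Abar. \<exists>B \<in> realizations Bbar. \<exists>C \<in> realizations Cbar.
        (\<Inter>K \<in> realizations Kbar. eigenvalues (A + B ** K ** C)) = {})"


section \<open>Minimum cost feedback selection\<close>

definition admissible ::
    "bool ^ 'n ^ 'n \<Rightarrow> bool ^ 'm ^ 'n \<Rightarrow> bool ^ 'n ^ 'p \<Rightarrow> (bool ^ 'p ^ 'm) set" where
  "admissible Abar Bbar Cbar = {Kbar. no_sfms Abar Bbar Cbar Kbar}"

text \<open>Costs are extended reals, the value \<open>\<infinity>\<close> marking a forbidden connection.\<close>

definition feedback_cost :: "ereal ^ 'p ^ 'm \<Rightarrow> bool ^ 'p ^ 'm \<Rightarrow> ereal" where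
  "feedback_cost P Kbar = (\<Sum>(i, j) \<in> {(i, j). Kbar $ i $ j}. P $ i $ j)"

definition optimal_solution ::
    "bool ^ 'n ^ 'n \<Rightarrow> bool ^ 'm ^ 'n \<Rightarrow> bool ^ 'n ^ 'p \<Rightarrow> ereal ^ 'p ^ 'm \<Rightarrow> bool ^ 'p ^ 'm \<Rightarrow> bool"
  where
  "optimal_solution Abar Bbar Cbar P Kbar \<longleftrightarrow>
     is_arg_min (feedback_cost P) (\<lambda>K. K \<in> admissible Abar Bbar Cbar) Kbar"

text \<open>The minimum is over a finite set, which is non-empty whenever
  \<^term>\<open>all_star\<close> is admissible.\<close>

definition optimal_cost ::
    "bool ^ 'n ^ 'n \<Rightarrow> bool ^ 'm ^ 'n \<Rightarrow> bool ^ 'n ^ 'p \<Rightarrow> ereal ^ 'p ^ 'm \<Rightarrow> ereal" where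
  "optimal_cost Abar Bbar Cbar P = Min (feedback_cost P ` admissible Abar Bbar Cbar)"


section \<open>State digraph and its DAG of strongly connected components\<close>

definition state_digraph :: "bool ^ 'n ^ 'n \<Rightarrow> ('n, 'n \<times> 'n) pre_digraph" where
  "state_digraph Abar =
     \<lparr>verts = UNIV, arcs = {(j, i). Abar $ i $ j}, tail = fst, head = snd\<rparr>"

definition scc_dag :: "('v, 'e) pre_digraph \<Rightarrow> ('v set, 'v set \<times> 'v set) pre_digraph" where
  "scc_dag G =
     \<lparr>verts = pre_digraph.sccs_verts G,
      arcs = {(S, T). S \<in> pre_digraph.sccs_verts G \<and> T \<in> pre_digraph.sccs_verts G \<and> S \<noteq> T \<and>
                      (\<exists>u \<in> S. \<exists>v \<in> T. (u, v) \<in> arcs_ends G)},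
      tail = fst, head = snd\<rparr>"

text \<open>The digraph is the directed elementary path running through the list \<open>vs\<close>,
  and has no further edges.\<close>

definition line_graph :: "('v, 'e) pre_digraph \<Rightarrow> 'v list \<Rightarrow> bool" where
  "line_graph G vs \<longleftrightarrow>
     distinct vs \<and> verts G = set vs \<and>
     arcs_ends G = {(vs ! k, vs ! Suc k) | k. Suc k < length vs}"


section \<open>Bipartite graphs and perfect matchings\<close>

text \<open>An edge \<open>(a, b)\<close> joins \<open>a\<close> in the first (primed) vertex class to \<open>b\<close> in the second one,
  so that the same name may be used for a vertex in either class.\<close>

definition matching :: "('a \<times> 'b) set \<Rightarrow> ('a \<times> 'b) set \<Rightarrow> bool" where
  "matching E M \<longleftrightarrow>
     M \<subseteq> E \<and> (\<forall>e \<in> M. \<forall>f \<in> M. e \<noteq> f \<longrightarrow> fst e \<noteq> fst f \<and> snd e \<noteq> snd f)"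

text \<open>Both vertex classes are \<open>UNIV\<close> of one and the same finite type.\<close>

definition perfect_matching :: "('a::finite \<times> 'a) set \<Rightarrow> ('a \<times> 'a) set \<Rightarrow> bool" where
  "perfect_matching E M \<longleftrightarrow> matching E M \<and> card M = CARD('a)"

definition state_bipartite :: "bool ^ 'n ^ 'n \<Rightarrow> ('n \<times> 'n) set" where
  "state_bipartite Abar = {(i, j). Abar $ i $ j}"

datatype ('n, 'm, 'p) vertex = State 'n | Input 'm | Output 'p

lemma UNIV_vertex: "(UNIV :: ('n, 'm, 'p) vertex set) = range State \<union> range Input \<union> range Output"
proof (intro equalityI subsetI)
  fix v :: "('n, 'm, 'p) vertex"
  show "v \<in> range State \<union> range Input \<union> range Output"
    by (cases v) auto
qed simp

instance vertex :: (finite, finite, finite) finite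
  by standard (simp add: UNIV_vertex)

definition system_bipartite ::
    "bool ^ 'n ^ 'n \<Rightarrow> bool ^ 'm ^ 'n \<Rightarrow> bool ^ 'n ^ 'p \<Rightarrow> bool ^ 'p ^ 'm \<Rightarrow>
     (('n, 'm, 'p) vertex \<times> ('n, 'm, 'p) vertex) set" where
  "system_bipartite Abar Bbar Cbar Kbar =
     {(State i, State j) | i j. Abar $ i $ j} \<union>
     {(State i, Input j) | i j. Bbar $ i $ j} \<union>
     {(Output j, State i) | j i. Cbar $ j $ i} \<union>
     {(Input i, Output j) | i j. Kbar $ i $ j} \<union>
     {(Input i, Input i) | i. True} \<union>
     {(Output j, Output j) | j. True}"

fun edge_cost :: "ereal ^ 'p ^ 'm \<Rightarrow> ('n, 'm, 'p) vertex \<times> ('n, 'm, 'p) vertex \<Rightarrow> ereal" where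
  "edge_cost P (Input i, Output j) = P $ i $ j"
| "edge_cost P _ = 0"

definition min_cost_perfect_matching ::
    "('a::finite \<times> 'a) set \<Rightarrow> ('a \<times> 'a \<Rightarrow> ereal) \<Rightarrow> ('a \<times> 'a) set \<Rightarrow> bool" where
  "min_cost_perfect_matching E c M \<longleftrightarrow> is_arg_min (sum c) (perfect_matching E) M"


section \<open>Dynamic programming algorithm\<close>

text \<open>The list \<open>Cs\<close> holds the components \<open>C\<^sub>1, \<dots>, C\<^sub>l\<close> in order;
  list indices start at 0, hence the shift.\<close>

definition component_inputs :: "bool ^ 'm ^ 'n \<Rightarrow> 'n set list \<Rightarrow> nat \<Rightarrow> 'm set" where
  "component_inputs Bbar Cs k = {i. \<exists>r \<in> Cs ! (k - 1). Bbar $ r $ i}"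

definition component_outputs :: "bool ^ 'n ^ 'p \<Rightarrow> 'n set list \<Rightarrow> nat \<Rightarrow> 'p set" where
  "component_outputs Cbar Cs k = {j. \<exists>r \<in> Cs ! (k - 1). Cbar $ j $ r}"

definition upstream_inputs :: "bool ^ 'm ^ 'n \<Rightarrow> 'n set list \<Rightarrow> nat \<Rightarrow> 'm set" where
  "upstream_inputs Bbar Cs k = (\<Union>q \<in> {1..k}. component_inputs Bbar Cs q)"

definition downstream_outputs :: "bool ^ 'n ^ 'p \<Rightarrow> 'n set list \<Rightarrow> nat \<Rightarrow> 'p set" where
  "downstream_outputs Cbar Cs k = (\<Union>q \<in> {k..length Cs}. component_outputs Cbar Cs q)"

definition candidate_edges ::
    "bool ^ 'm ^ 'n \<Rightarrow> bool ^ 'n ^ 'p \<Rightarrow> 'n set list \<Rightarrow> nat \<Rightarrow> ('p \<times> 'm) set" where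
  "candidate_edges Bbar Cbar Cs k = downstream_outputs Cbar Cs k \<times> upstream_inputs Bbar Cs k"

text \<open>Used only for inputs in \<^term>\<open>upstream_inputs Bbar Cs k\<close> with \<open>k \<le> length Cs\<close>;
  the value is then in \<open>{1..k}\<close>.\<close>

definition first_component :: "bool ^ 'm ^ 'n \<Rightarrow> 'n set list \<Rightarrow> 'm \<Rightarrow> nat" where
  "first_component Bbar Cs i = (LEAST q. i \<in> upstream_inputs Bbar Cs q)"

text \<open>
  The algorithm leaves the choice among several minimizers open, so its runs form a relation:
  \<open>W\<close> and \<open>S\<close> are the tables computed by one run, on arguments \<open>0, \<dots>, length Cs\<close>.
  In step \<open>k\<close> an edge attaining the minimum is required explicitly; there is no run
  if some set of candidate edges is empty.
\<close>

definition dp_run ::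
    "bool ^ 'm ^ 'n \<Rightarrow> bool ^ 'n ^ 'p \<Rightarrow> ereal ^ 'p ^ 'm \<Rightarrow> 'n set list \<Rightarrow>
     (nat \<Rightarrow> ereal) \<Rightarrow> (nat \<Rightarrow> ('p \<times> 'm) set) \<Rightarrow> bool" where
  "dp_run Bbar Cbar P Cs W S \<longleftrightarrow>
     W 0 = 0 \<and> S 0 = {} \<and>
     (\<forall>k \<in> {1..length Cs}.
        W k = Min ((\<lambda>(j, i). P $ i $ j + W (first_component Bbar Cs i - 1)) `
                     candidate_edges Bbar Cbar Cs k) \<and>
        (\<exists>(w, v) \<in> candidate_edges Bbar Cbar Cs k.
           W k = P $ v $ w + W (first_component Bbar Cs v - 1) \<and>
           S k = {(w, v)} \<union> S (first_component Bbar Cs v - 1)))"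

definition dp_output ::
    "bool ^ 'm ^ 'n \<Rightarrow> bool ^ 'n ^ 'p \<Rightarrow> ereal ^ 'p ^ 'm \<Rightarrow> 'n set list \<Rightarrow> bool ^ 'p ^ 'm \<Rightarrow> bool"
  where
  "dp_output Bbar Cbar P Cs Ka \<longleftrightarrow>
     (\<exists>W S. dp_run Bbar Cbar P Cs W S \<and> Ka = (\<chi> i j. (j, i) \<in> S (length Cs)))"


section \<open>Two-stage algorithm\<close>

definition two_stage_output ::
    "bool ^ 'n ^ 'n \<Rightarrow> bool ^ 'm ^ 'n \<Rightarrow> bool ^ 'n ^ 'p \<Rightarrow> ereal ^ 'p ^ 'm \<Rightarrow> 'n set list \<Rightarrow>
     bool ^ 'p ^ 'm \<Rightarrow> bool" where
  "two_stage_output Abar Bbar Cbar P Cs KA \<longleftrightarrow>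
     (\<exists>Ka M Kb.
        dp_output Bbar Cbar P Cs Ka \<and>
        min_cost_perfect_matching (system_bipartite Abar Bbar Cbar all_star) (edge_cost P) M \<and>
        Kb = (\<chi> i j. (Input i, Output j) \<in> M) \<and>
        KA = (\<chi> i j. Ka $ i $ j \<or> Kb $ i $ j))"

end

theory Submission
  imports Defs "HOL-Computational_Algebra.Fundamental_Theorem_Algebra"
begin

text \<open>
  When the components form a line, a feedback edge \<open>(y\<^sub>j, u\<^sub>i)\<close> closes a loop through exactly those
  components that lie between the first one driven by \<open>u\<^sub>i\<close> and the last one read by \<open>y\<^sub>j\<close>; it is
  an interval, and \<^const>\<open>candidate_edges\<close> at \<open>k\<close> collects the edges whose interval contains \<open>k\<close>.
  The heart of the matter is that there are no fixed modes iff the intervals of the feedback edges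
  cover all components and the system bipartite graph has a perfect matching
  (\<open>no_sfms_iff_candidate_cover\<close>). The rest is combinatorics. Feedback selection becomes
  weighted interval covering together with a matching condition. The recursion for \<open>W\<close> solves the
  covering problem exactly, because an edge chosen for \<open>k\<close> takes care of everything from its first
  component up to \<open>k\<close> and leaves the same problem for the components before it. If \<open>\<B>(A)\<close> has a
  perfect matching, the matching condition holds for every feedback pattern, and the cover is
  optimal. Otherwise the optimal pattern pays at least for a cheapest cover and at least for a
  cheapest matching, hence the union of the two costs at most twice as much.

  Necessity of the two conditions. If no feedback edge covers component \<open>k\<close>, every closed loop
  matrix is block triangular with the same diagonal block on that component, whose eigenvalues are
  then fixed (\<open>uncovered_layer_imp_sfms\<close>). If \<open>0\<close> is not a fixed mode, some \<open>A + B K C\<close> is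
  nonsingular, hence so is a larger matrix that has \<open>A\<close>, \<open>B\<close>, \<open>C\<close>, \<open>K\<close> as blocks, and a nonzero
  term of its determinant is a perfect matching (\<open>no_sfms_imp_perfect_matching\<close>).

  Sufficiency. The matching provides a gain and a strictly positive realization with \<open>A + B K C\<close>
  nonsingular; this excludes the mode \<open>0\<close>, and it persists for all but finitely many values of any
  single entry of \<open>A\<close>. Suppose that all such realizations have a fixed mode. When one entry
  \<open>A\<^sub>i\<^sub>j\<close> varies and everything else stays, the common eigenvalues of the open loop and of the loop
  closed by an edge covering the state \<open>j\<close> lie in a finite set that does not depend on the value of
  \<open>A\<^sub>i\<^sub>j\<close> (\<open>finite_moving_common_eigenvalues\<close>). So some number is a fixed mode for infinitely many
  values of the entry, and then for all of them, the determinant being polynomial in the entry.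
  Releasing the entries of \<open>A\<close> one after the other in this way yields a nonzero fixed mode that
  is there for all \<open>A\<close>, even for \<open>A = 0\<close> without feedback, where the only eigenvalue is \<open>0\<close>
  (\<open>positive_realization_without_fixed_modes\<close>).
\<close>

section \<open>Polynomial functions and their zeros\<close>

definition poly_fun :: "(complex \<Rightarrow> complex) \<Rightarrow> bool" where
  "poly_fun f \<longleftrightarrow> (\<exists>p. f = poly p)"

lemma poly_fun_const [intro]: "poly_fun (\<lambda>z. c)"
  unfolding poly_fun_def by (rule exI[of _ "[:c:]"]) auto

lemma poly_fun_id [intro]: "poly_fun (\<lambda>z. z)"
  unfolding poly_fun_def by (rule exI[of _ "[:0, 1:]"]) auto

lemma poly_fun_add [intro]: "poly_fun f \<Longrightarrow> poly_fun g \<Longrightarrow> poly_fun (\<lambda>z. f z + g z)"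
  unfolding poly_fun_def by (elim exE, rule_tac x = "p + pa" in exI) auto

lemma poly_fun_mult [intro]: "poly_fun f \<Longrightarrow> poly_fun g \<Longrightarrow> poly_fun (\<lambda>z. f z * g z)"
  unfolding poly_fun_def by (elim exE, rule_tac x = "p * pa" in exI) auto

lemma poly_fun_diff [intro]: "poly_fun f \<Longrightarrow> poly_fun g \<Longrightarrow> poly_fun (\<lambda>z. f z - g z)"
  unfolding poly_fun_def by (elim exE, rule_tac x = "p - pa" in exI) auto

lemma poly_fun_sum: "(\<And>a. a \<in> S \<Longrightarrow> poly_fun (f a)) \<Longrightarrow> poly_fun (\<lambda>z. \<Sum>a\<in>S. f a z)"
  by (induction S rule: infinite_finite_induct) auto

lemma poly_fun_prod: "(\<And>a. a \<in> S \<Longrightarrow> poly_fun (f a)) \<Longrightarrow> poly_fun (\<lambda>z. \<Prod>a\<in>S. f a z)"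
  by (induction S rule: infinite_finite_induct) auto

lemma poly_fun_det:
  fixes X :: "complex \<Rightarrow> complex ^ 'n ^ 'n"
  assumes "\<And>i j. poly_fun (\<lambda>z. X z $ i $ j)"
  shows "poly_fun (\<lambda>z. det (X z))"
  unfolding det_def by (intro poly_fun_sum poly_fun_mult poly_fun_prod poly_fun_const assms)

lemma poly_fun_finite_zeros:
  assumes "poly_fun f" "f w \<noteq> 0"
  shows "finite {z. f z = 0}"
proof -
  obtain p where p: "f = poly p" using assms(1) by (auto simp: poly_fun_def)
  then have "p \<noteq> 0" using assms(2) by auto
  then show ?thesis using p poly_roots_finite by auto
qed

section \<open>Resolvents\<close>

lemma det_eq_0_iff_kernel:
  fixes X :: "'a::field ^ 'n ^ 'n"
  shows "det X = 0 \<longleftrightarrow> (\<exists>v. v \<noteq> 0 \<and> X *v v = 0)"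
  using invertible_det_nz[of X] invertible_left_inverse[of X] matrix_left_invertible_ker[of X]
  by metis

lemma det_nonzero_solvable:
  fixes X :: "'a::field ^ 'n ^ 'n"
  assumes "det X \<noteq> 0"
  obtains x where "X *v x = b"
  using cramer[OF assms, of _ b] by blast

lemma mat_diff_mult_vector:
  fixes A :: "'a::field ^ 'n ^ 'n"
  shows "(mat z - A) *v x = z *s x - A *v x"
proof -
  have "mat z *v x = z *s x"
  proof (subst vec_eq_iff, rule allI)
    fix i
    have "(mat z *v x) $ i = (\<Sum>j\<in>UNIV. if i = j then z * x $ j else 0)"
      unfolding matrix_vector_mult_def mat_def vec_lambda_beta by (rule sum.cong) auto
    then show "(mat z *v x) $ i = (z *s x) $ i" by simp
  qed
  then show ?thesis by (simp add: matrix_vector_mult_diff_rdistrib)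
qed

lemma resolvent_unique:
  fixes A :: "'a::field ^ 'n ^ 'n"
  assumes "det (mat z - A) \<noteq> 0" "z *s x = A *v x + b" "z *s y = A *v y + b"
  shows "x = y"
proof -
  have "(mat z - A) *v (x - y) = 0"
    unfolding matrix_vector_mult_diff_distrib mat_diff_mult_vector using assms(2,3) by simp
  then have "x - y = 0" using assms(1) det_eq_0_iff_kernel by blast
  then show ?thesis by simp
qed

lemma resolvent_exists:
  fixes A :: "'a::field ^ 'n ^ 'n"
  assumes "det (mat z - A) \<noteq> 0"
  obtains x where "z *s x = A *v x + b"
proof -
  obtain x where "(mat z - A) *v x = b" using det_nonzero_solvable[OF assms] by blast
  then have "z *s x = A *v x + b"
    unfolding mat_diff_mult_vector by (simp only: diff_eq_eq add.commute)
  then show ?thesis using that by blast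
qed

abbreviation cmat :: "real ^ 'c ^ 'r \<Rightarrow> complex ^ 'c ^ 'r" where
  "cmat \<equiv> map_matrix complex_of_real"

lemma eigenvalues_iff_det: "z \<in> eigenvalues T \<longleftrightarrow> det (mat z - cmat T) = 0"
  unfolding eigenvalues_def det_eq_0_iff_kernel mat_diff_mult_vector by auto

lemma det_cmat: "det (cmat T) = complex_of_real (det T)"
  unfolding det_def by simp

lemma finite_eigenvalues_det:
  fixes A :: "complex ^ 'n ^ 'n"
  assumes "det (mat w - A) \<noteq> 0"
  shows "finite {z. det (mat z - A) = 0}"
proof -
  have "poly_fun (\<lambda>z. det (mat z - A))"
  proof (rule poly_fun_det)
    fix i j show "poly_fun (\<lambda>z. (mat z - A) $ i $ j)"
      by (cases "i = j") (auto simp: mat_def)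
  qed
  then show ?thesis using poly_fun_finite_zeros assms by blast
qed

text \<open>
  By Cramer's rule the entries of the resolvent are quotients of polynomials in \<open>z\<close>; hence a linear
  form of a resolvent column that is nonzero at one point vanishes at finitely many points only.
\<close>

lemma finite_resolvent_zeros:
  fixes A :: "complex ^ 'n ^ 'n"
  assumes w: "det (mat w - A) \<noteq> 0"
    and x0: "w *s x0 = A *v x0 + b" and nz: "(\<Sum>r\<in>UNIV. c $ r * x0 $ r) \<noteq> 0"
  shows "finite {z. det (mat z - A) \<noteq> 0 \<and>
           (\<exists>x. z *s x = A *v x + b \<and> (\<Sum>r\<in>UNIV. c $ r * x $ r) = 0)}"
proof -
  define N where "N z k = det (\<chi> i j. if j = k then b $ i else (mat z - A) $ i $ j)" for z k
  define f where "f z = (\<Sum>k\<in>UNIV. c $ k * N z k)" for z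
  have solve: "(\<Sum>r\<in>UNIV. c $ r * x $ r) = f z / det (mat z - A)"
    if "det (mat z - A) \<noteq> 0" "z *s x = A *v x + b" for z x
  proof -
    have "(mat z - A) *v x = b" unfolding mat_diff_mult_vector using that(2) by simp
    then have "x $ k = N z k / det (mat z - A)" for k
      using cramer[OF that(1)] by (simp add: N_def)
    then show ?thesis by (simp add: f_def sum_divide_distrib)
  qed
  have "poly_fun f"
    unfolding f_def N_def
  proof (intro poly_fun_sum poly_fun_mult poly_fun_const poly_fun_det)
    fix k i j
    show "poly_fun (\<lambda>z. (\<chi> i j. if j = k then b $ i else (mat z - A) $ i $ j) $ i $ j)"
      by (cases "j = k"; cases "i = j") (auto simp: mat_def)
  qed
  moreover have "f w \<noteq> 0" using solve[OF w x0] nz by auto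
  ultimately have "finite {z. f z = 0}" using poly_fun_finite_zeros by blast
  then show ?thesis
    by (rule finite_subset[rotated]) (use solve in auto)
qed

text \<open>
  Let \<open>R = (z - A)\<^sup>-\<^sup>1\<close>, so that \<open>y\<^sub>1 = R b\<close> and \<open>y\<^sub>2 = R e\<^sub>i\<close>. An eigenvector of \<open>A + t e\<^sub>i e\<^sub>j\<^sup>T\<close>
  at \<open>z\<close> exists only if \<open>t R\<^sub>j\<^sub>i = 1\<close>. An eigenvector of \<open>A + t e\<^sub>i e\<^sub>j\<^sup>T + b c\<^sup>T\<close> is a combination of
  \<open>y\<^sub>1\<close> and \<open>y\<^sub>2\<close>, and its \<open>j\<close>-th entry reproduces itself up to a multiple of \<open>(R b)\<^sub>j\<close>. Together this
  forces \<open>(e\<^sub>j\<^sup>T R b) (c\<^sup>T R e\<^sub>i) = 0\<close>, a condition on \<open>z\<close> in which \<open>t\<close> does not occur.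
\<close>

lemma common_eigenvalue_rank_two:
  fixes A :: "complex ^ 'n ^ 'n"
  assumes nz: "det (mat z - A) \<noteq> 0"
    and v: "v \<noteq> 0" "z *s v = A *v v + (t * v $ j) *s axis i 1"
    and x: "x \<noteq> 0" "z *s x = A *v x + ((t * x $ j) *s axis i 1 + (\<Sum>r\<in>UNIV. c $ r * x $ r) *s b)"
    and y1: "z *s y1 = A *v y1 + b"
    and y2: "z *s y2 = A *v y2 + axis i 1"
  shows "y1 $ j = 0 \<or> (\<Sum>r\<in>UNIV. c $ r * y2 $ r) = 0"
proof -
  let ?cx = "\<Sum>r\<in>UNIV. c $ r * x $ r"
  have v_eq: "v = (t * v $ j) *s y2"
  proof (rule resolvent_unique[OF nz v(2)])
    have "z *s (a *s y2) = a *s (z *s y2)" for a by (simp add: vec_eq_iff)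
    then show "z *s ((t * v $ j) *s y2) = A *v ((t * v $ j) *s y2) + (t * v $ j) *s axis i 1"
      by (simp add: y2 vec.scale_right_distrib matrix_vector_mult_scaleR vec.scale del: vector_smult_assoc)
  qed
  have x_eq: "x = (t * x $ j) *s y2 + ?cx *s y1"
  proof (rule resolvent_unique[OF nz x(2)])
    have c: "z *s (a *s y + a' *s y') = a *s (z *s y) + a' *s (z *s y')" for a a' and y y' :: "complex^'n"
      by (simp add: vec_eq_iff algebra_simps)
    show "z *s ((t * x $ j) *s y2 + ?cx *s y1) = A *v ((t * x $ j) *s y2 + ?cx *s y1)
        + ((t * x $ j) *s axis i 1 + ?cx *s b)"
      unfolding c y1 y2
      by (simp add: vec.scale_right_distrib vec.add vec.scale del: vector_smult_assoc)
  qed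
  have "v $ j \<noteq> 0" using v(1) v_eq by auto
  moreover have "v $ j = t * v $ j * y2 $ j" using arg_cong[OF v_eq, of "\<lambda>u. u $ j"] by simp
  ultimately have t: "t * y2 $ j = 1" by (metis mult.assoc mult.commute mult_cancel_left2)
  have "x $ j = t * x $ j * y2 $ j + ?cx * y1 $ j" using arg_cong[OF x_eq, of "\<lambda>u. u $ j"] by simp
  also have "t * x $ j * y2 $ j = x $ j" using t by (simp add: algebra_simps)
  finally have "?cx * y1 $ j = 0" by simp
  moreover have "(\<Sum>r\<in>UNIV. c $ r * y2 $ r) = 0" if cx: "?cx = 0"
  proof -
    have xe: "x = (t * x $ j) *s y2" using x_eq unfolding cx by simp
    then have "t * x $ j \<noteq> 0" using x(1) by auto
    moreover have "?cx = (t * x $ j) * (\<Sum>r\<in>UNIV. c $ r * y2 $ r)"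
    proof -
      have "x $ r = t * x $ j * y2 $ r" for r using arg_cong[OF xe, of "\<lambda>u. u $ r"] by simp
      then have "?cx = (\<Sum>r\<in>UNIV. c $ r * (t * x $ j * y2 $ r))" by (metis (lifting))
      also have "\<dots> = (t * x $ j) * (\<Sum>r\<in>UNIV. c $ r * y2 $ r)"
        unfolding sum_distrib_left by (rule sum.cong) auto
      finally show ?thesis .
    qed
    ultimately show ?thesis using cx by auto
  qed
  ultimately show ?thesis by auto
qed

text \<open>
  A principal block, padded with the identity: it is singular iff the block is, and it still is a
  matrix over the full index type.
\<close>

definition block_or_id :: "'n set \<Rightarrow> 'a::zero_neq_one ^ 'n ^ 'n \<Rightarrow> 'a ^ 'n ^ 'n" where
  "block_or_id D X = (\<chi> r s. if r \<in> D \<and> s \<in> D then X $ r $ s else if r = s then 1 else 0)"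

lemma block_or_id_mult:
  fixes X :: "'a::field ^ 'n ^ 'n"
  shows "(block_or_id D X *v x) $ r = (if r \<in> D then \<Sum>s\<in>D. X $ r $ s * x $ s else x $ r)"
proof (cases "r \<in> D")
  case True
  have "(block_or_id D X *v x) $ r = (\<Sum>s\<in>UNIV. if s \<in> D then X $ r $ s * x $ s else 0)"
    unfolding matrix_vector_mult_def block_or_id_def vec_lambda_beta using True
    by (intro sum.cong) auto
  then show ?thesis using True by (simp add: sum.If_cases)
next
  case False
  have "(block_or_id D X *v x) $ r = (\<Sum>s\<in>UNIV. if r = s then x $ s else 0)"
    unfolding matrix_vector_mult_def block_or_id_def vec_lambda_beta using False
    by (intro sum.cong) auto
  then show ?thesis using False by simp
qed

lemma mult_supported:
  fixes X :: "'a::field ^ 'n ^ 'n"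
  assumes "\<And>s. s \<notin> D \<Longrightarrow> x $ s = 0"
  shows "(X *v x) $ r = (\<Sum>s\<in>D. X $ r $ s * x $ s)"
  unfolding matrix_vector_mult_def vec_lambda_beta
  by (rule sum.mono_neutral_right) (use assms in auto)

text \<open>
  The vectors supported in \<open>D\<close> form an invariant subspace; an injective linear map of a
  finite-dimensional space into itself is onto.
\<close>

lemma solvable_in_invariant_subspace:
  fixes X :: "'a::field ^ 'n ^ 'n"
  assumes nz: "det X \<noteq> 0" and inv: "\<And>r s. r \<notin> D \<Longrightarrow> s \<in> D \<Longrightarrow> X $ r $ s = 0"
    and b: "\<And>r. r \<notin> D \<Longrightarrow> b $ r = 0"
  obtains y where "X *v y = b" "\<And>s. s \<notin> D \<Longrightarrow> y $ s = 0"
proof -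
  have lift: "X *v y = c" if y: "block_or_id D X *v y = c" and c: "\<And>r. r \<notin> D \<Longrightarrow> c $ r = 0" for y c
  proof -
    have supp: "y $ s = 0" if "s \<notin> D" for s
      using arg_cong[OF y, of "\<lambda>u. u $ s"] c[OF that] that by (simp add: block_or_id_mult)
    show ?thesis
    proof (subst vec_eq_iff, rule allI)
      fix r
      show "(X *v y) $ r = c $ r"
        using mult_supported[of D y X r, OF supp] arg_cong[OF y, of "\<lambda>u. u $ r"] c[of r] inv[of r]
        by (cases "r \<in> D") (auto simp: block_or_id_mult)
    qed
  qed
  have "det (block_or_id D X) \<noteq> 0"
  proof
    assume "det (block_or_id D X) = 0"
    then obtain v where "v \<noteq> 0" "block_or_id D X *v v = 0" using det_eq_0_iff_kernel by blast
    then show False using lift[of v 0] nz det_eq_0_iff_kernel by auto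
  qed
  then obtain y where y: "block_or_id D X *v y = b" by (rule det_nonzero_solvable)
  have "y $ s = 0" if "s \<notin> D" for s
    using arg_cong[OF y, of "\<lambda>u. u $ s"] b[OF that] that by (simp add: block_or_id_mult)
  with lift[OF y b] show ?thesis using that by blast
qed

section \<open>Eigenvalues of a positive realization that survive a feedback\<close>

definition influences :: "bool ^ 'n ^ 'n \<Rightarrow> ('n \<times> 'n) set" where
  "influences Abar = {(s, r). Abar $ r $ s}"

definition positive_realization :: "bool ^ 'c ^ 'r \<Rightarrow> real ^ 'c ^ 'r \<Rightarrow> bool" where
  "positive_realization S X \<longleftrightarrow> (\<forall>i j. if S $ i $ j then 0 < X $ i $ j else X $ i $ j = 0)"

lemma positive_realization_pos: "positive_realization S X \<Longrightarrow> S $ i $ j \<Longrightarrow> 0 < X $ i $ j"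
  and positive_realization_zero: "positive_realization S X \<Longrightarrow> \<not> S $ i $ j \<Longrightarrow> X $ i $ j = 0"
  unfolding positive_realization_def by metis+

lemma positive_realization_nonneg: "positive_realization S X \<Longrightarrow> 0 \<le> X $ i $ j"
  unfolding positive_realization_def by (metis order_less_imp_le order_refl)

text \<open>
  A discrete minimum principle: at an index where \<open>x\<close> is smallest, \<open>z x\<^sub>i\<close> is at least the \<open>i\<close>-th
  row sum times \<open>x\<^sub>i\<close>, which is impossible for negative \<open>x\<^sub>i\<close> if \<open>z\<close> exceeds the row sum.
\<close>

lemma resolvent_nonneg:
  fixes A :: "real ^ 'n ^ 'n"
  assumes A: "\<And>r s. 0 \<le> A $ r $ s" and z: "\<And>r. (\<Sum>s\<in>UNIV. A $ r $ s) < z"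
    and x: "z *s x = A *v x + b" and b: "\<And>r. 0 \<le> b $ r"
  shows "0 \<le> x $ r"
proof -
  obtain i where "is_arg_min (($) x) (\<lambda>k. k \<in> UNIV) i"
    using ex_is_arg_min_if_finite[of UNIV "($) x"] by auto
  then have i: "x $ i \<le> x $ k" for k by (simp add: is_arg_min_linorder)
  let ?rs = "\<Sum>s\<in>UNIV. A $ i $ s"
  have "?rs * x $ i = (\<Sum>s\<in>UNIV. A $ i $ s * x $ i)" by (simp add: sum_distrib_right)
  also have "\<dots> \<le> (\<Sum>s\<in>UNIV. A $ i $ s * x $ s)" by (intro sum_mono mult_left_mono i A)
  also have "\<dots> \<le> z * x $ i"
    using arg_cong[OF x, of "\<lambda>u. u $ i"] b[of i] by (simp add: matrix_vector_mult_def)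
  finally have "0 \<le> (z - ?rs) * x $ i" by (simp add: algebra_simps)
  moreover have "0 < z - ?rs" using z[of i] by simp
  ultimately have "0 \<le> x $ i" by (simp add: zero_le_mult_iff)
  then show ?thesis using i[of r] by linarith
qed

text \<open>
  Positivity spreads along the edges of the state digraph. This is how graph reachability enters:
  it makes the polynomials of \<open>common_eigenvalue_rank_two\<close> nonzero at a large real point.
\<close>

lemma resolvent_pos_downstream:
  fixes A :: "real ^ 'n ^ 'n"
  assumes A: "positive_realization Abar A" and z: "\<And>r. (\<Sum>s\<in>UNIV. A $ r $ s) < z"
    and x: "z *s x = A *v x + b" and b: "\<And>r. 0 \<le> b $ r" and s: "0 < b $ s"
    and reach: "(s, r) \<in> (influences Abar)\<^sup>*"
  shows "0 < x $ r"
proof -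
  have Ann: "0 \<le> A $ r $ s" for r s using A by (rule positive_realization_nonneg)
  have xnn: "0 \<le> x $ r" for r using resolvent_nonneg[OF Ann z x b] .
  have "0 \<le> (\<Sum>s\<in>UNIV. A $ r $ s)" for r by (intro sum_nonneg Ann)
  then have zpos: "0 < z" using z[of r] by (metis order_le_less_trans)
  have row: "z * x $ r = (\<Sum>s\<in>UNIV. A $ r $ s * x $ s) + b $ r" for r
    using arg_cong[OF x, of "\<lambda>u. u $ r"] by (simp add: matrix_vector_mult_def)
  show ?thesis using reach
  proof (induction rule: rtrancl_induct)
    case base
    have "0 \<le> (\<Sum>k\<in>UNIV. A $ s $ k * x $ k)" by (intro sum_nonneg mult_nonneg_nonneg Ann xnn)
    then have "0 < z * x $ s" using row[of s] s by linarith
    then show ?case using zpos by (simp add: zero_less_mult_iff)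
  next
    case (step r r')
    then have "0 < A $ r' $ r * x $ r"
      using positive_realization_pos[OF A] by (auto simp: influences_def)
    also have "\<dots> \<le> (\<Sum>k\<in>UNIV. A $ r' $ k * x $ k)"
      by (rule member_le_sum) (auto intro: mult_nonneg_nonneg Ann xnn)
    also have "\<dots> \<le> z * x $ r'" using row[of r'] b[of r'] by linarith
    finally show ?case using zpos by (simp add: zero_less_mult_iff)
  qed
qed

lemma det_resolvent_nonneg:
  fixes A :: "real ^ 'n ^ 'n"
  assumes A: "\<And>r s. 0 \<le> A $ r $ s" and z: "\<And>r. (\<Sum>s\<in>UNIV. A $ r $ s) < z"
  shows "det (mat z - A) \<noteq> 0"
proof
  assume "det (mat z - A) = 0"
  then obtain v where v: "v \<noteq> 0" "(mat z - A) *v v = 0" using det_eq_0_iff_kernel by blast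
  then have eq: "z *s v = A *v v + 0" by (simp add: mat_diff_mult_vector)
  have "- (z *s v) = - (A *v v)" using eq by simp
  then have eq': "z *s (- v) = A *v (- v) + 0" by (simp add: vec.neg)
  have "v $ r = 0" for r
    using resolvent_nonneg[OF A z eq, of r] resolvent_nonneg[OF A z eq', of r] by simp
  then show False using v(1) by (simp add: vec_eq_iff)
qed

lemma cmat_mat_diff: "cmat (mat z - A) = mat (complex_of_real z) - cmat A"
  by (simp add: vec_eq_iff mat_def)

definition cvec :: "real ^ 'n \<Rightarrow> complex ^ 'n" where
  "cvec x = (\<chi> r. complex_of_real (x $ r))"

lemma cvec_nth [simp]: "cvec x $ r = complex_of_real (x $ r)"
  by (simp add: cvec_def)

lemma cvec_resolvent:
  assumes "z *s x = A *v x + b"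
  shows "complex_of_real z *s cvec x = cmat A *v cvec x + cvec b"
proof (subst vec_eq_iff, rule allI)
  fix r
  have "z * x $ r = (\<Sum>s\<in>UNIV. A $ r $ s * x $ s) + b $ r"
    using arg_cong[OF assms, of "\<lambda>u. u $ r"] by (simp add: matrix_vector_mult_def)
  then have "complex_of_real (z * x $ r) = complex_of_real ((\<Sum>s\<in>UNIV. A $ r $ s * x $ s) + b $ r)"
    by simp
  then show "(complex_of_real z *s cvec x) $ r = (cmat A *v cvec x + cvec b) $ r"
    by (simp add: matrix_vector_mult_def)
qed

lemma cvec_axis: "cvec (axis i 1) = axis i 1"
  by (simp add: vec_eq_iff axis_def)

lemma sum_axis_mult: "(\<Sum>r\<in>UNIV. axis j 1 $ r * x $ r) = (x $ j :: 'a::comm_ring_1)"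
proof -
  have "(\<Sum>r\<in>UNIV. axis j 1 $ r * x $ r) = (\<Sum>r\<in>UNIV. if r = j then x $ r else 0)"
    by (rule sum.cong) (auto simp: axis_def)
  then show ?thesis by simp
qed

text \<open>
  The matrix with a single entry replaced; as a function of \<open>t\<close> it is the line along which a free
  entry is moved.
\<close>

definition set_entry :: "'a ^ 'n ^ 'n \<Rightarrow> 'n \<Rightarrow> 'n \<Rightarrow> 'a \<Rightarrow> 'a ^ 'n ^ 'n" where
  "set_entry A i j t = (\<chi> r s. if r = i \<and> s = j then t else A $ r $ s)"

lemma set_entry_nth: "set_entry A i j t $ r $ s = (if r = i \<and> s = j then t else A $ r $ s)"
  by (simp add: set_entry_def)

definition outer :: "'a::times ^ 'r \<Rightarrow> 'a ^ 'c \<Rightarrow> 'a ^ 'c ^ 'r" where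
  "outer b c = (\<chi> r s. b $ r * c $ s)"

lemma cmat_set_entry_mult:
  "cmat (set_entry A i j t) *v x =
     cmat A *v x + (complex_of_real (t - A $ i $ j) * x $ j) *s axis i 1"
proof (subst vec_eq_iff, rule allI)
  fix r
  have "(cmat (set_entry A i j t) *v x) $ r - (cmat A *v x) $ r =
     (\<Sum>s\<in>UNIV. (complex_of_real (set_entry A i j t $ r $ s) - complex_of_real (A $ r $ s)) * x $ s)"
    by (simp add: matrix_vector_mult_def sum_subtractf algebra_simps)
  also have "\<dots> = (\<Sum>s\<in>UNIV. if s = j then (if r = i then complex_of_real (t - A $ i $ j) * x $ j else 0) else 0)"
    by (rule sum.cong) (auto simp: set_entry_nth)
  also have "\<dots> = ((complex_of_real (t - A $ i $ j) * x $ j) *s axis i 1) $ r"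
    by (simp add: axis_def)
  finally show "(cmat (set_entry A i j t) *v x) $ r =
      (cmat A *v x + (complex_of_real (t - A $ i $ j) * x $ j) *s axis i 1) $ r"
    by (simp add: algebra_simps)
qed

lemma cmat_add_mult: "cmat (A + A') *v x = cmat A *v x + cmat A' *v x"
proof -
  have "cmat (A + A') = cmat A + cmat A'" by (simp add: vec_eq_iff)
  then show ?thesis by (simp add: matrix_vector_mult_add_rdistrib)
qed

lemma cmat_outer_mult:
  "cmat (outer b c) *v x = (\<Sum>r\<in>UNIV. cvec c $ r * x $ r) *s cvec b"
  by (simp add: vec_eq_iff matrix_vector_mult_def outer_def sum_distrib_left mult_ac)

text \<open>
  If \<open>i\<close> reaches \<open>j\<close> in the state digraph, then \<open>b\<close> reaches \<open>j\<close>, and \<open>i\<close> reaches \<open>c\<close> by way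
  of \<open>j\<close>; the rank-two criterion bounds the common eigenvalues by the zeros of two
  nonzero polynomials. Otherwise the entry lies on no cycle, and the spectrum of the open loop does
  not depend on it at all. The base point is \<open>A\<close> itself rather than \<open>A\<close> with a zero entry, so
  that all walks of the state digraph remain available.
\<close>

lemma finite_moving_common_eigenvalues:
  fixes A :: "real ^ 'n ^ 'n"
  assumes A: "positive_realization Abar A" and ij: "Abar $ i $ j"
    and b: "\<And>r. 0 \<le> b $ r" "0 < b $ rb" "(rb, j) \<in> (influences Abar)\<^sup>*"
    and c: "\<And>r. 0 \<le> c $ r" "0 < c $ rc" "(j, rc) \<in> (influences Abar)\<^sup>*"
  shows "finite {z. \<exists>t. t \<noteq> A $ i $ j \<and> z \<in> eigenvalues (set_entry A i j t) \<and>
                        z \<in> eigenvalues (set_entry A i j t + outer b c)}"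
    (is "finite ?F")
proof -
  have Ann: "0 \<le> A $ r $ s" for r s using A by (rule positive_realization_nonneg)
  \<comment> \<open>A real point to the right of all row sums, where resolvent columns are nonnegative.\<close>
  define w where "w = 1 + (\<Sum>r\<in>UNIV. \<Sum>s\<in>UNIV. A $ r $ s)"
  have w: "(\<Sum>s\<in>UNIV. A $ r $ s) < w" for r
  proof -
    have "(\<Sum>s\<in>UNIV. A $ r $ s) \<le> (\<Sum>r\<in>UNIV. \<Sum>s\<in>UNIV. A $ r $ s)"
      by (rule member_le_sum) (auto intro: sum_nonneg Ann)
    then show ?thesis by (simp add: w_def)
  qed
  have rdet: "det (mat w - A) \<noteq> 0" using det_resolvent_nonneg[OF Ann w] .
  then have cdet: "det (mat (complex_of_real w) - cmat A) \<noteq> 0"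
    unfolding cmat_mat_diff[symmetric] det_cmat by simp
  define sing where "sing = {z. det (mat z - cmat A) = 0}"
  have "finite sing" unfolding sing_def using finite_eigenvalues_det[OF cdet] .
  obtain x where x: "w *s x = A *v x + axis i 1" using resolvent_exists[OF rdet] by blast
  have axis: "0 \<le> (axis i 1 :: real ^ 'n) $ r" "0 < (axis i 1 :: real ^ 'n) $ i" for r
    by (auto simp: axis_def)
  show ?thesis
  proof (cases "(i, j) \<in> (influences Abar)\<^sup>*")
    case True
    obtain y where y: "w *s y = A *v y + b" using resolvent_exists[OF rdet] by blast
    have "0 < y $ j" using resolvent_pos_downstream[OF A w y b] .
    then have nz1: "(\<Sum>r\<in>UNIV. axis j 1 $ r * cvec y $ r) \<noteq> 0"
      unfolding sum_axis_mult by simp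
    define Z1 where "Z1 = {z. det (mat z - cmat A) \<noteq> 0 \<and>
           (\<exists>x. z *s x = cmat A *v x + cvec b \<and> (\<Sum>r\<in>UNIV. axis j 1 $ r * x $ r) = 0)}"
    have "finite Z1"
      unfolding Z1_def by (rule finite_resolvent_zeros[OF cdet cvec_resolvent[OF y] nz1])
    have "(i, rc) \<in> (influences Abar)\<^sup>*" using True c(3) by (rule rtrancl_trans)
    then have xrc: "0 < x $ rc" using resolvent_pos_downstream[OF A w x axis] by blast
    have xnn: "0 \<le> x $ r" for r using resolvent_nonneg[OF Ann w x axis(1)] .
    have "0 < c $ rc * x $ rc" using c(2) xrc by simp
    also have "\<dots> \<le> (\<Sum>r\<in>UNIV. c $ r * x $ r)"
      by (rule member_le_sum) (auto intro: mult_nonneg_nonneg c xnn)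
    finally have "complex_of_real (\<Sum>r\<in>UNIV. c $ r * x $ r) \<noteq> 0" by (metis of_real_eq_0_iff less_irrefl)
    then have nz2: "(\<Sum>r\<in>UNIV. cvec c $ r * cvec x $ r) \<noteq> 0" by simp
    define Z2 where "Z2 = {z. det (mat z - cmat A) \<noteq> 0 \<and>
           (\<exists>x. z *s x = cmat A *v x + axis i 1 \<and> (\<Sum>r\<in>UNIV. cvec c $ r * x $ r) = 0)}"
    have "finite Z2"
      unfolding Z2_def
      by (rule finite_resolvent_zeros[OF cdet cvec_resolvent[OF x, unfolded cvec_axis] nz2])
    have "?F \<subseteq> sing \<union> Z1 \<union> Z2"
    proof
      fix z assume "z \<in> ?F"
      then obtain t u v where u: "u \<noteq> 0" "cmat (set_entry A i j t) *v u = z *s u"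
        and v: "v \<noteq> 0" "cmat (set_entry A i j t + outer b c) *v v = z *s v"
        unfolding eigenvalues_def by blast
      define d where "d = complex_of_real (t - A $ i $ j)"
      have u2: "z *s u = cmat A *v u + (d * u $ j) *s axis i 1"
        using u(2) unfolding cmat_set_entry_mult d_def by simp
      have v2: "z *s v = cmat A *v v + ((d * v $ j) *s axis i 1 +
                  (\<Sum>r\<in>UNIV. cvec c $ r * v $ r) *s cvec b)"
        using v(2) unfolding cmat_add_mult cmat_set_entry_mult cmat_outer_mult d_def
        by (simp add: add.assoc)
      show "z \<in> sing \<union> Z1 \<union> Z2"
      proof (cases "det (mat z - cmat A) = 0")
        case False
        obtain y1 where y1: "z *s y1 = cmat A *v y1 + cvec b" using resolvent_exists[OF False] by blast
        obtain y2 where y2: "z *s y2 = cmat A *v y2 + axis i 1" using resolvent_exists[OF False] by blast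
        have "y1 $ j = 0 \<or> (\<Sum>r\<in>UNIV. cvec c $ r * y2 $ r) = 0"
          by (rule common_eigenvalue_rank_two[OF False u(1) u2 v(1) v2 y1 y2])
        then show ?thesis
        proof
          assume "y1 $ j = 0"
          then have "z \<in> Z1" unfolding Z1_def sum_axis_mult using False y1 by blast
          then show ?thesis by blast
        next
          assume "(\<Sum>r\<in>UNIV. cvec c $ r * y2 $ r) = 0"
          then have "z \<in> Z2" unfolding Z2_def using False y2 by blast
          then show ?thesis by blast
        qed
      qed (simp add: sing_def)
    qed
    then show ?thesis using \<open>finite sing\<close> \<open>finite Z1\<close> \<open>finite Z2\<close> by (meson finite_UnI finite_subset)
  next
    case False
    have "?F \<subseteq> sing"
    proof
      fix z assume "z \<in> ?F"
      then obtain t u where u: "u \<noteq> 0" "cmat (set_entry A i j t) *v u = z *s u"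
        unfolding eigenvalues_def by blast
      define d where "d = complex_of_real (t - A $ i $ j)"
      have u2: "z *s u = cmat A *v u + (d * u $ j) *s axis i 1"
        using u(2) unfolding cmat_set_entry_mult d_def by simp
      show "z \<in> sing"
      proof (rule ccontr)
        assume "z \<notin> sing"
        then have nz: "det (mat z - cmat A) \<noteq> 0" by (simp add: sing_def)
        \<comment> \<open>The response to \<open>e\<^sub>i\<close> stays in the set of states reachable from \<open>i\<close>, which misses \<open>j\<close>.\<close>
        define D where "D = {s. (i, s) \<in> (influences Abar)\<^sup>*}"
        have "(mat z - cmat A) $ r $ s = 0" if "r \<notin> D" "s \<in> D" for r s
        proof -
          have "r \<noteq> s" using that by auto
          moreover have "\<not> Abar $ r $ s"
          proof
            assume "Abar $ r $ s"
            then have "(s, r) \<in> influences Abar" by (simp add: influences_def)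
            then show False using that unfolding D_def by (auto intro: rtrancl_into_rtrancl)
          qed
          ultimately show ?thesis using positive_realization_zero[OF A] by (simp add: mat_def)
        qed
        moreover have "((d * u $ j) *s axis i 1) $ r = 0" if "r \<notin> D" for r
          using that unfolding D_def by (auto simp: axis_def)
        ultimately obtain y where y: "(mat z - cmat A) *v y = (d * u $ j) *s axis i 1"
          "\<And>s. s \<notin> D \<Longrightarrow> y $ s = 0"
          using solvable_in_invariant_subspace[OF nz] by blast
        have "z *s y = cmat A *v y + (d * u $ j) *s axis i 1"
          using y(1) unfolding mat_diff_mult_vector by (simp only: diff_eq_eq add.commute)
        then have "u = y" using resolvent_unique[OF nz u2] by blast
        moreover have "j \<notin> D" using False by (simp add: D_def)
        ultimately have "u $ j = 0" using y(2) by simp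
        then have "z *s u = cmat A *v u" using u2 by simp
        then have "(mat z - cmat A) *v u = 0" unfolding mat_diff_mult_vector by simp
        then show False using nz u(1) det_eq_0_iff_kernel by blast
      qed
    qed
    then show ?thesis using \<open>finite sing\<close> finite_subset by blast
  qed
qed

section \<open>Generic realizations have no fixed modes\<close>

definition unit_gain :: "'m \<Rightarrow> 'p \<Rightarrow> real ^ 'p ^ 'm" where
  "unit_gain p q = (\<chi> i j. if i = p \<and> j = q then 1 else 0)"

lemma unit_gain_closed_loop: "B ** unit_gain p q ** C = outer (column p B) (row q C)"
proof (subst vec_eq_iff, rule allI, subst vec_eq_iff, rule allI)
  fix r s
  have inner: "(B ** unit_gain p q) $ r $ k = (if k = q then B $ r $ p else 0)" for k
  proof -
    have "(B ** unit_gain p q) $ r $ k = (\<Sum>l\<in>UNIV. if l = p then (if k = q then B $ r $ p else 0) else 0)"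
      unfolding matrix_matrix_mult_def unit_gain_def vec_lambda_beta by (rule sum.cong) auto
    then show ?thesis by simp
  qed
  have "(B ** unit_gain p q ** C) $ r $ s = (\<Sum>k\<in>UNIV. (B ** unit_gain p q) $ r $ k * C $ k $ s)"
    by (simp only: matrix_matrix_mult_def[of "B ** unit_gain p q"] vec_lambda_beta)
  also have "\<dots> = (\<Sum>k\<in>UNIV. if k = q then B $ r $ p * C $ q $ s else 0)"
    by (rule sum.cong) (auto simp: inner)
  finally show "(B ** unit_gain p q ** C) $ r $ s = outer (column p B) (row q C) $ r $ s"
    by (simp add: outer_def column_def row_def)
qed

lemma unit_gain_realization: "Kbar $ p $ q \<Longrightarrow> unit_gain p q \<in> realizations Kbar"
  by (auto simp: realizations_def unit_gain_def)

lemma zero_realization: "0 \<in> realizations S"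
  by (simp add: realizations_def)

lemma matrix_mult_0: "(B :: real ^ 'm ^ 'n) ** (0 :: real ^ 'p ^ 'm) ** (C :: real ^ 'k ^ 'p) = 0"
  by (simp add: vec_eq_iff matrix_matrix_mult_def)

lemma set_entry_same: "set_entry A i j (A $ i $ j) = A"
  by (simp add: vec_eq_iff set_entry_nth)

lemma cmat_set_entry_add:
  "cmat (set_entry A i j t + G) = set_entry (cmat A) i j (complex_of_real t) + cmat G"
  by (simp add: vec_eq_iff set_entry_nth)

lemma poly_fun_det_set_entry:
  fixes X Y :: "complex ^ 'n ^ 'n"
  shows "poly_fun (\<lambda>w. det (set_entry X i j w + Y))"
    and "poly_fun (\<lambda>w. det (Y - (set_entry X i j w + Z)))"
proof -
  have e: "poly_fun (\<lambda>w. set_entry X i j w $ r $ s)" for r s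
    by (cases "r = i \<and> s = j") (auto simp: set_entry_nth)
  show "poly_fun (\<lambda>w. det (set_entry X i j w + Y))"
    by (rule poly_fun_det) (simp add: e poly_fun_add poly_fun_const)
  show "poly_fun (\<lambda>w. det (Y - (set_entry X i j w + Z)))"
    by (rule poly_fun_det) (simp add: e poly_fun_add poly_fun_diff poly_fun_const)
qed

lemma infinite_of_real_image: "infinite T \<Longrightarrow> infinite (complex_of_real ` T)"
  using finite_imageD[of complex_of_real T] inj_on_subset[OF inj_of_real] by blast

text \<open>
  The entries of \<open>A\<close> are released one at a time. The induction statement \<open>persistent S\<close> says that
  for every positive \<open>A\<close> for which the gain \<open>KM\<close> gives a nonsingular closed loop there is a nonzero
  number that stays a fixed mode whatever values the entries in \<open>S\<close> take. The new values need be
  neither positive nor generic, which permits setting \<open>A = 0\<close> in the end.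
\<close>

lemma positive_realization_without_fixed_modes:
  fixes Abar :: "bool ^ 'n ^ 'n" and Kbar :: "bool ^ 'p ^ 'm"
  assumes B: "positive_realization Bbar B" and C: "positive_realization Cbar C"
    and cover: "\<And>x. \<exists>p q. Kbar $ p $ q \<and> (\<exists>r. Bbar $ r $ p \<and> (r, x) \<in> (influences Abar)\<^sup>*) \<and>
                                  (\<exists>r. Cbar $ q $ r \<and> (x, r) \<in> (influences Abar)\<^sup>*)"
    and A0: "positive_realization Abar A0"
    and KM: "KM \<in> realizations Kbar" "det (A0 + B ** KM ** C) \<noteq> 0"
  shows "\<exists>A. positive_realization Abar A \<and>
             (\<Inter>K \<in> realizations Kbar. eigenvalues (A + B ** K ** C)) = {}"
proof (rule ccontr)
  assume neg: "\<not> ?thesis"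
  define persistent where "persistent S \<longleftrightarrow>
    (\<forall>A. positive_realization Abar A \<and> det (A + B ** KM ** C) \<noteq> 0 \<longrightarrow>
      (\<exists>z. z \<noteq> 0 \<and> (\<forall>A'. (\<forall>i j. (i, j) \<notin> S \<longrightarrow> A' $ i $ j = A $ i $ j) \<longrightarrow>
         (\<forall>K \<in> realizations Kbar. z \<in> eigenvalues (A' + B ** K ** C)))))" for S
  have start: "persistent {}"
    unfolding persistent_def
  proof (intro allI impI)
    fix A assume A: "positive_realization Abar A \<and> det (A + B ** KM ** C) \<noteq> 0"
    then obtain z where z: "z \<in> (\<Inter>K \<in> realizations Kbar. eigenvalues (A + B ** K ** C))"
      using neg by blast
    have "0 \<notin> eigenvalues (A + B ** KM ** C)"
    proof
      assume "0 \<in> eigenvalues (A + B ** KM ** C)"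
      then have "det (cmat (A + B ** KM ** C)) = 0"
        unfolding eigenvalues_def det_eq_0_iff_kernel by auto
      then show False using A by (simp add: det_cmat)
    qed
    then have "z \<noteq> 0" using z KM(1) by blast
    moreover have "\<forall>A'. (\<forall>i j. (i, j) \<notin> {} \<longrightarrow> A' $ i $ j = A $ i $ j) \<longrightarrow>
         (\<forall>K \<in> realizations Kbar. z \<in> eigenvalues (A' + B ** K ** C))"
    proof (intro allI impI)
      fix A' assume "\<forall>i j. (i, j) \<notin> {} \<longrightarrow> A' $ i $ j = A $ i $ j"
      then have "A' = A" by (simp add: vec_eq_iff)
      then show "\<forall>K \<in> realizations Kbar. z \<in> eigenvalues (A' + B ** K ** C)" using z by blast
    qed
    ultimately show "\<exists>z. z \<noteq> 0 \<and> (\<forall>A'. (\<forall>i j. (i, j) \<notin> {} \<longrightarrow> A' $ i $ j = A $ i $ j) \<longrightarrow>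
         (\<forall>K \<in> realizations Kbar. z \<in> eigenvalues (A' + B ** K ** C)))" by blast
  qed
  have extend: "persistent (insert (i, j) S)" if S: "persistent S" and ij: "Abar $ i $ j" for i j S
    unfolding persistent_def
  proof (intro allI impI)
    fix A assume "positive_realization Abar A \<and> det (A + B ** KM ** C) \<noteq> 0"
    then have A: "positive_realization Abar A" and dA: "det (A + B ** KM ** C) \<noteq> 0" by auto
    obtain p q rb rc where pq: "Kbar $ p $ q" "Bbar $ rb $ p" "(rb, j) \<in> (influences Abar)\<^sup>*"
      "Cbar $ q $ rc" "(j, rc) \<in> (influences Abar)\<^sup>*"
      using cover[of j] by blast
    \<comment> \<open>Admissible values of the entry: the realization remains positive and the closed loop nonsingular.\<close>
    define T where "T = {t. 0 < t \<and> det (set_entry A i j t + B ** KM ** C) \<noteq> 0} - {A $ i $ j}"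
    have infT: "infinite T"
    proof -
      let ?f = "\<lambda>w. det (set_entry (cmat A) i j w + cmat (B ** KM ** C))"
      have f: "?f (complex_of_real t) = complex_of_real (det (set_entry A i j t + B ** KM ** C))" for t
        unfolding cmat_set_entry_add[symmetric] det_cmat ..
      have "?f (complex_of_real (A $ i $ j)) \<noteq> 0" unfolding f set_entry_same using dA by simp
      then have "finite {w. ?f w = 0}" by (rule poly_fun_finite_zeros[OF poly_fun_det_set_entry(1)])
      then have "finite {t. ?f (complex_of_real t) = 0}"
        using finite_vimageI[OF _ inj_of_real, of "{w. ?f w = 0}"] by (simp add: vimage_def)
      then have fin: "finite ({t. det (set_entry A i j t + B ** KM ** C) = 0} \<union> {A $ i $ j})"
        unfolding f by simp
      have "T = {0<..} - ({t. det (set_entry A i j t + B ** KM ** C) = 0} \<union> {A $ i $ j})"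
        unfolding T_def by auto
      moreover have "infinite {0::real<..}" by (rule infinite_Ioi)
      ultimately show ?thesis using Diff_infinite_finite[OF fin] by metis
    qed
    have "\<exists>z. z \<noteq> 0 \<and> (\<forall>A'. (\<forall>r s. (r, s) \<notin> S \<longrightarrow> A' $ r $ s = set_entry A i j t $ r $ s) \<longrightarrow>
         (\<forall>K \<in> realizations Kbar. z \<in> eigenvalues (A' + B ** K ** C)))" if "t \<in> T" for t
    proof -
      have "positive_realization Abar (set_entry A i j t)"
        using A that ij unfolding positive_realization_def T_def by (auto simp: set_entry_nth)
      then show ?thesis using S that unfolding persistent_def T_def by blast
    qed
    then obtain \<zeta> where \<zeta>: "\<And>t. t \<in> T \<Longrightarrow> \<zeta> t \<noteq> 0"
      "\<And>t A' K. t \<in> T \<Longrightarrow> (\<And>r s. (r, s) \<notin> S \<Longrightarrow> A' $ r $ s = set_entry A i j t $ r $ s) \<Longrightarrow>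
         K \<in> realizations Kbar \<Longrightarrow> \<zeta> t \<in> eigenvalues (A' + B ** K ** C)"
      by metis
    have "\<zeta> ` T \<subseteq> {z. \<exists>t. t \<noteq> A $ i $ j \<and> z \<in> eigenvalues (set_entry A i j t) \<and>
                        z \<in> eigenvalues (set_entry A i j t + outer (column p B) (row q C))}"
    proof (rule image_subsetI)
      fix t assume t: "t \<in> T"
      have "\<zeta> t \<in> eigenvalues (set_entry A i j t + B ** 0 ** C)"
        by (rule \<zeta>(2)[OF t _ zero_realization]) simp
      moreover have "\<zeta> t \<in> eigenvalues (set_entry A i j t + B ** unit_gain p q ** C)"
        by (rule \<zeta>(2)[OF t _ unit_gain_realization[OF pq(1)]]) simp
      moreover have "t \<noteq> A $ i $ j" using t by (simp add: T_def)
      ultimately show "\<zeta> t \<in> {z. \<exists>t. t \<noteq> A $ i $ j \<and> z \<in> eigenvalues (set_entry A i j t) \<and>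
                        z \<in> eigenvalues (set_entry A i j t + outer (column p B) (row q C))}"
        unfolding matrix_mult_0 unit_gain_closed_loop by auto
    qed
    moreover have "finite {z. \<exists>t. t \<noteq> A $ i $ j \<and> z \<in> eigenvalues (set_entry A i j t) \<and>
                        z \<in> eigenvalues (set_entry A i j t + outer (column p B) (row q C))}"
    proof (rule finite_moving_common_eigenvalues[OF A ij])
      show "0 \<le> column p B $ r" for r using positive_realization_nonneg[OF B] by (simp add: column_def)
      show "0 \<le> row q C $ r" for r using positive_realization_nonneg[OF C] by (simp add: row_def)
      show "0 < column p B $ rb" using positive_realization_pos[OF B pq(2)] by (simp add: column_def)
      show "0 < row q C $ rc" using positive_realization_pos[OF C pq(4)] by (simp add: row_def)
    qed (use pq in auto)
    \<comment> \<open>Infinitely many values of the entry share one mode.\<close>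
    ultimately have "finite (\<zeta> ` T)" by (rule finite_subset)
    then obtain t0 where t0: "t0 \<in> T" and inf: "infinite {t \<in> T. \<zeta> t = \<zeta> t0}"
      using pigeonhole_infinite[OF infT] by blast
    have "\<zeta> t0 \<in> eigenvalues (A' + B ** K ** C)"
      if A': "\<And>r s. (r, s) \<notin> insert (i, j) S \<Longrightarrow> A' $ r $ s = A $ r $ s"
        and K: "K \<in> realizations Kbar" for A' K
    proof -
      \<comment> \<open>A polynomial in the entry with infinitely many zeros.\<close>
      let ?f = "\<lambda>w. det (mat (\<zeta> t0) - (set_entry (cmat A') i j w + cmat (B ** K ** C)))"
      have zero: "?f (complex_of_real t) = 0" if t: "t \<in> T" "\<zeta> t = \<zeta> t0" for t
      proof -
        have "\<zeta> t \<in> eigenvalues (set_entry A' i j t + B ** K ** C)"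
          by (rule \<zeta>(2)[OF t(1) _ K]) (auto simp: set_entry_nth A')
        then show ?thesis unfolding eigenvalues_iff_det cmat_set_entry_add t(2) .
      qed
      have "infinite (complex_of_real ` {t \<in> T. \<zeta> t = \<zeta> t0})" using infinite_of_real_image[OF inf] .
      moreover have "complex_of_real ` {t \<in> T. \<zeta> t = \<zeta> t0} \<subseteq> {w. ?f w = 0}" using zero by auto
      ultimately have "infinite {w. ?f w = 0}" using finite_subset by blast
      then have "?f (complex_of_real (A' $ i $ j)) = 0"
        using poly_fun_finite_zeros[OF poly_fun_det_set_entry(2)] by blast
      then show ?thesis
        unfolding eigenvalues_iff_det cmat_set_entry_add[symmetric] set_entry_same .
    qed
    then show "\<exists>z. z \<noteq> 0 \<and> (\<forall>A'. (\<forall>r s. (r, s) \<notin> insert (i, j) S \<longrightarrow> A' $ r $ s = A $ r $ s) \<longrightarrow>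
         (\<forall>K \<in> realizations Kbar. z \<in> eigenvalues (A' + B ** K ** C)))"
      using \<zeta>(1)[OF t0] by blast
  qed
  \<comment> \<open>Only starred entries are released; the others vanish anyway.\<close>
  have "persistent S" if "finite S" "S \<subseteq> {(i, j). Abar $ i $ j}" for S
    using that
  proof (induction S rule: finite_induct)
    case (insert e S)
    then show ?case using extend by (cases e) auto
  qed (rule start)
  then have "persistent {(i, j). Abar $ i $ j}" by simp
  from this[unfolded persistent_def, THEN spec, THEN mp, OF conjI[OF A0 KM(2)]]
  obtain z where z: "z \<noteq> 0"
    "\<forall>A'. (\<forall>i j. (i, j) \<notin> {(i, j). Abar $ i $ j} \<longrightarrow> A' $ i $ j = A0 $ i $ j) \<longrightarrow>
       (\<forall>K \<in> realizations Kbar. z \<in> eigenvalues (A' + B ** K ** C))"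
    by (elim exE conjE)
  have "\<forall>K \<in> realizations Kbar. z \<in> eigenvalues (0 + B ** K ** C)"
    by (rule z(2)[THEN spec, THEN mp]) (use positive_realization_zero[OF A0] in simp)
  then have "z \<in> eigenvalues (0 + B ** 0 ** C)" using zero_realization by (rule bspec)
  then obtain v where v: "v \<noteq> 0" "cmat (0 + B ** 0 ** C) *v v = z *s v"
    unfolding eigenvalues_def by blast
  have "cmat (0 + B ** 0 ** C) = 0" unfolding matrix_mult_0 by (simp add: vec_eq_iff)
  then have "z *s v = 0" using v(2) by simp
  then show False using z(1) v(1) by simp
qed

section \<open>Perfect matchings and nonsingular closed loops\<close>

lemma perfect_matching_iff_permutation:
  fixes E :: "('a::finite \<times> 'a) set"
  shows "perfect_matching E M \<longleftrightarrow> (\<exists>f. inj f \<and> M = {(a, f a) | a. True} \<and> M \<subseteq> E)"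
proof
  assume pm: "perfect_matching E M"
  then have dis: "\<And>e f. e \<in> M \<Longrightarrow> f \<in> M \<Longrightarrow> e \<noteq> f \<Longrightarrow> fst e \<noteq> fst f \<and> snd e \<noteq> snd f"
    and card: "card M = CARD('a)" and sub: "M \<subseteq> E"
    unfolding perfect_matching_def matching_def by auto
  have "inj_on fst M" using dis by (meson inj_onI)
  then have "card (fst ` M) = CARD('a)" using card by (simp add: card_image)
  then have onto: "fst ` M = UNIV" by (metis card_subset_eq finite subset_UNIV)
  have "\<exists>b. (a, b) \<in> M" for a
  proof -
    have "a \<in> fst ` M" using onto by simp
    then show ?thesis by force
  qed
  then obtain f where f: "\<And>a. (a, f a) \<in> M" by metis
  have "M = {(a, f a) | a. True}"
  proof (intro equalityI subsetI)
    fix e assume e: "e \<in> M"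
    then have "e = (fst e, f (fst e))" using dis[OF e f[of "fst e"]] by auto
    then show "e \<in> {(a, f a) | a. True}" by blast
  qed (use f in auto)
  moreover have "inj f" by (rule injI) (metis dis f fst_conv snd_conv)
  ultimately show "\<exists>f. inj f \<and> M = {(a, f a) | a. True} \<and> M \<subseteq> E" using sub by blast
next
  assume "\<exists>f. inj f \<and> M = {(a, f a) | a. True} \<and> M \<subseteq> E"
  then obtain f where f: "inj f" "M = {(a, f a) | a. True}" "M \<subseteq> E" by blast
  have "M = (\<lambda>a. (a, f a)) ` UNIV" using f(2) by auto
  then have "card M = CARD('a)" by (simp add: card_image inj_on_def)
  then show "perfect_matching E M"
    unfolding perfect_matching_def matching_def using f by (auto dest: injD)
qed

text \<open>
  Shifting all free entries by the same \<open>t\<close>. The element type is left open because the determinant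
  is studied as a polynomial in a complex \<open>t\<close> and used for a real one.
\<close>

definition add_pattern :: "bool ^ 'c ^ 'r \<Rightarrow> 'a::comm_ring_1 \<Rightarrow> 'a ^ 'c ^ 'r \<Rightarrow> 'a ^ 'c ^ 'r" where
  "add_pattern S t X = (\<chi> i j. X $ i $ j + t * of_bool (S $ i $ j))"

lemma positive_add_pattern:
  assumes "X \<in> realizations S" "\<And>i j. 0 \<le> X $ i $ j" "0 < t"
  shows "positive_realization S (add_pattern S t X)"
  using assms unfolding positive_realization_def add_pattern_def realizations_def
  by (auto intro: add_nonneg_pos)

text \<open>
  Nonsingularity is the nonvanishing of a polynomial in \<open>t\<close>; it holds at \<open>t = 0\<close>, hence at some
  \<open>t > 0\<close>, where all free entries are positive.
\<close>

lemma ex_positive_realization_nonsingular: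
  fixes Abar :: "bool ^ 'n ^ 'n" and K :: "real ^ 'p ^ 'm"
  assumes A: "A \<in> realizations Abar" "\<And>i j. 0 \<le> A $ i $ j"
    and B: "B \<in> realizations Bbar" "\<And>i j. 0 \<le> B $ i $ j"
    and C: "C \<in> realizations Cbar" "\<And>i j. 0 \<le> C $ i $ j"
    and nz: "det (A + B ** K ** C) \<noteq> 0"
  obtains A' B' C' where "positive_realization Abar A'" "positive_realization Bbar B'"
    "positive_realization Cbar C'" "det (A' + B' ** K ** C') \<noteq> 0"
proof -
  let ?X = "\<lambda>w. add_pattern Abar w (cmat A) + add_pattern Bbar w (cmat B) ** cmat K ** add_pattern Cbar w (cmat C)"
  let ?Y = "\<lambda>t. add_pattern Abar t A + add_pattern Bbar t B ** K ** add_pattern Cbar t C"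
  have X: "?X (complex_of_real t) = cmat (?Y t)" for t
  proof -
    have "complex_of_real (of_bool c) = of_bool c" for c by (cases c) auto
    then show ?thesis by (simp add: vec_eq_iff add_pattern_def matrix_matrix_mult_def)
  qed
  have poly: "poly_fun (\<lambda>w. det (?X w))"
    by (rule poly_fun_det)
      (auto simp: add_pattern_def matrix_matrix_mult_def
        intro!: poly_fun_sum poly_fun_mult poly_fun_add poly_fun_const poly_fun_id)
  have "?Y 0 = A + B ** K ** C" by (simp add: add_pattern_def vec_eq_iff matrix_matrix_mult_def)
  then have "det (?X (complex_of_real 0)) \<noteq> 0" unfolding X det_cmat using nz by simp
  then have "finite {w. det (?X w) = 0}" by (rule poly_fun_finite_zeros[OF poly])
  then have "finite (complex_of_real -` {w. det (?X w) = 0})"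
    using finite_vimageI inj_of_real by blast
  then have "\<not> {0::real<..} \<subseteq> complex_of_real -` {w. det (?X w) = 0}"
    using infinite_Ioi[of "0::real"] finite_subset by blast
  then obtain t where t: "0 < t" "det (?X (complex_of_real t)) \<noteq> 0" by blast
  then have "det (?Y t) \<noteq> 0" unfolding X det_cmat by simp
  then show ?thesis
    using that positive_add_pattern[OF A t(1)] positive_add_pattern[OF B t(1)]
      positive_add_pattern[OF C t(1)] by blast
qed

lemma positive_realization_realization: "positive_realization S X \<Longrightarrow> X \<in> realizations S"
  by (simp add: positive_realization_zero realizations_def)

text \<open>
  The 0/1 matrices whose nonzero entries are the matched edges. In a kernel vector, every signal is
  forced to vanish by the unique vertex that is matched to it: first the inputs, then the outputs,
  and finally the states.
\<close>

lemma perfect_matching_nonsingular_closed_loop: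
  fixes Abar :: "bool ^ 'n ^ 'n" and Bbar :: "bool ^ 'm ^ 'n" and Cbar :: "bool ^ 'n ^ 'p"
  assumes "perfect_matching (system_bipartite Abar Bbar Cbar Kbar) M"
  obtains A B C K where "A \<in> realizations Abar" "\<And>i j. 0 \<le> A $ i $ j"
    "B \<in> realizations Bbar" "\<And>i j. 0 \<le> B $ i $ j"
    "C \<in> realizations Cbar" "\<And>i j. 0 \<le> C $ i $ j"
    "K \<in> realizations Kbar" "det (A + B ** K ** C) \<noteq> 0"
proof -
  obtain f where inj: "inj f" and M: "M = {(a, f a) | a. True}" "M \<subseteq> system_bipartite Abar Bbar Cbar Kbar"
    using assms unfolding perfect_matching_iff_permutation by blast
  have edge: "(a, f a) \<in> system_bipartite Abar Bbar Cbar Kbar" for a using M by blast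
  have surj: "\<exists>a. f a = b" for b using finite_UNIV_inj_surj[OF _ inj] by (metis finite surjD)
  define A :: "real ^ 'n ^ 'n" where "A = (\<chi> i j. of_bool (f (State i) = State j))"
  define B :: "real ^ 'm ^ 'n" where "B = (\<chi> i j. of_bool (f (State i) = Input j))"
  define C :: "real ^ 'n ^ 'p" where "C = (\<chi> i j. of_bool (f (Output i) = State j))"
  define K :: "real ^ 'p ^ 'm" where "K = (\<chi> i j. of_bool (f (Input i) = Output j))"
  have real: "A \<in> realizations Abar" "B \<in> realizations Bbar" "C \<in> realizations Cbar" "K \<in> realizations Kbar"
  proof -
    have "f (State i) = State j \<Longrightarrow> Abar $ i $ j" for i j
      using edge[of "State i"] by (auto simp: system_bipartite_def)
    then show "A \<in> realizations Abar" by (auto simp: realizations_def A_def)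
    have "f (State i) = Input j \<Longrightarrow> Bbar $ i $ j" for i j
      using edge[of "State i"] by (auto simp: system_bipartite_def)
    then show "B \<in> realizations Bbar" by (auto simp: realizations_def B_def)
    have "f (Output i) = State j \<Longrightarrow> Cbar $ i $ j" for i j
      using edge[of "Output i"] by (auto simp: system_bipartite_def)
    then show "C \<in> realizations Cbar" by (auto simp: realizations_def C_def)
    have "f (Input i) = Output j \<Longrightarrow> Kbar $ i $ j" for i j
      using edge[of "Input i"] by (auto simp: system_bipartite_def)
    then show "K \<in> realizations Kbar" by (auto simp: realizations_def K_def)
  qed
  have "det (A + B ** K ** C) \<noteq> 0"
  proof
    assume "det (A + B ** K ** C) = 0"
    then obtain x where x: "x \<noteq> 0" "(A + B ** K ** C) *v x = 0" using det_eq_0_iff_kernel by blast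
    define y where "y = C *v x"
    define u where "u = K *v y"
    have state: "A *v x + B *v u = 0"
      using x(2) unfolding y_def u_def by (simp add: matrix_vector_mult_add_rdistrib matrix_vector_mul_assoc matrix_mul_assoc)
    have single: "(\<Sum>j\<in>UNIV. of_bool (a = g j) * v $ j) = (\<Sum>j\<in>{j. a = g j}. v $ j)"
      for a and g :: "'k::finite \<Rightarrow> ('n, 'm, 'p) vertex" and v :: "real ^ 'k"
      by (simp add: of_bool_def if_distrib[of "\<lambda>c. c * _"] sum.If_cases cong: if_cong)
    have rowA: "(A *v x) $ i = (\<Sum>j\<in>{j. f (State i) = State j}. x $ j)" for i
      unfolding matrix_vector_mult_def A_def by (simp add: single)
    have rowB: "(B *v u) $ i = (\<Sum>j\<in>{j. f (State i) = Input j}. u $ j)" for i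
      unfolding matrix_vector_mult_def B_def by (simp add: single)
    have rowC: "y $ i = (\<Sum>j\<in>{j. f (Output i) = State j}. x $ j)" for i
      unfolding y_def matrix_vector_mult_def C_def by (simp add: single)
    have rowK: "u $ i = (\<Sum>j\<in>{j. f (Input i) = Output j}. y $ j)" for i
      unfolding u_def matrix_vector_mult_def K_def by (simp add: single)
    have row: "(A *v x) $ i + (B *v u) $ i = 0" for i
      using arg_cong[OF state, of "\<lambda>v. v $ i"] by simp
    have u0: "u $ p = 0" for p
    proof -
      obtain a where a: "f a = Input p" using surj by blast
      show ?thesis
      proof (cases a)
        case (State i)
        then show ?thesis using row[of i] a by (simp add: rowA rowB)
      next
        case (Input i)
        then show ?thesis using edge[of a] a rowK[of p] by (auto simp: system_bipartite_def)
      next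
        case (Output i)
        then show ?thesis using edge[of a] a by (auto simp: system_bipartite_def)
      qed
    qed
    have y0: "y $ q = 0" for q
    proof -
      obtain a where a: "f a = Output q" using surj by blast
      show ?thesis
      proof (cases a)
        case (State i)
        then show ?thesis using edge[of a] a by (auto simp: system_bipartite_def)
      next
        case (Input i)
        then show ?thesis using a rowK[of i] u0[of i] by simp
      next
        case (Output i)
        then show ?thesis using edge[of a] a rowC[of q] by (auto simp: system_bipartite_def)
      qed
    qed
    have "x $ r = 0" for r
    proof -
      obtain a where a: "f a = State r" using surj by blast
      show ?thesis
      proof (cases a)
        case (State i)
        then show ?thesis using row[of i] a by (simp add: rowA rowB)
      next
        case (Input i)
        then show ?thesis using edge[of a] a by (auto simp: system_bipartite_def)
      next
        case (Output i)
        then show ?thesis using a rowC[of i] y0[of i] by simp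
      qed
    qed
    then show False using x(1) by (simp add: vec_eq_iff)
  qed
  moreover have "0 \<le> A $ i $ j" "0 \<le> B $ i $ l" "0 \<le> C $ k $ j" for i j k l
    by (auto simp: A_def B_def C_def)
  ultimately show ?thesis using that real by blast
qed

text \<open>
  A criterion for arbitrary state digraphs: each state must lie between the input and the output of
  one single feedback edge. For a line of components the criterion is also necessary.
\<close>

theorem no_sfms_sufficient:
  fixes Abar :: "bool ^ 'n ^ 'n" and Bbar :: "bool ^ 'm ^ 'n" and Cbar :: "bool ^ 'n ^ 'p"
  assumes cover: "\<And>x. \<exists>p q. Kbar $ p $ q \<and> (\<exists>r. Bbar $ r $ p \<and> (r, x) \<in> (influences Abar)\<^sup>*) \<and>
                                  (\<exists>r. Cbar $ q $ r \<and> (x, r) \<in> (influences Abar)\<^sup>*)"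
    and M: "perfect_matching (system_bipartite Abar Bbar Cbar Kbar) M"
  shows "no_sfms Abar Bbar Cbar Kbar"
proof -
  obtain A0 B0 C0 K where 0: "A0 \<in> realizations Abar" "\<And>i j. 0 \<le> A0 $ i $ j"
    "B0 \<in> realizations Bbar" "\<And>i j. 0 \<le> B0 $ i $ j"
    "C0 \<in> realizations Cbar" "\<And>i j. 0 \<le> C0 $ i $ j"
    and K: "K \<in> realizations Kbar" "det (A0 + B0 ** K ** C0) \<noteq> 0"
    using perfect_matching_nonsingular_closed_loop[OF M] by blast
  obtain A1 B C where 1: "positive_realization Abar A1" "positive_realization Bbar B"
    "positive_realization Cbar C" "det (A1 + B ** K ** C) \<noteq> 0"
    using ex_positive_realization_nonsingular[OF 0 K(2)] by blast
  obtain A where A: "positive_realization Abar A"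
    "(\<Inter>K \<in> realizations Kbar. eigenvalues (A + B ** K ** C)) = {}"
    using positive_realization_without_fixed_modes[OF 1(2,3) cover 1(1) K(1) 1(4)] by blast
  show ?thesis
    unfolding no_sfms_def
    by (rule bexI[of _ A], rule bexI[of _ B], rule bexI[of _ C], rule A(2))
      (simp_all add: positive_realization_realization 1(2,3) A(1))
qed

lemma sum_vertex:
  fixes g :: "('n::finite, 'm::finite, 'p::finite) vertex \<Rightarrow> 'a::comm_monoid_add"
  shows "sum g UNIV = (\<Sum>i\<in>UNIV. g (State i)) + (\<Sum>i\<in>UNIV. g (Input i)) + (\<Sum>i\<in>UNIV. g (Output i))"
proof -
  have "sum g UNIV = sum g (range State) + sum g (range Input) + sum g (range Output)"
    unfolding UNIV_vertex by (subst sum.union_disjoint, auto)+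
  then show ?thesis by (simp add: sum.reindex inj_on_def)
qed

text \<open>
  Keeping inputs and outputs as extra unknowns turns \<open>A x + B K C x = 0\<close> into the linear system
  \<open>A x + B u = 0\<close>, \<open>u = K y\<close>, \<open>y = C x\<close>, whose coefficient matrix has its nonzero entries on edges of
  the system bipartite graph, the loops being the \<open>-1\<close> entries of the last two equations.
\<close>

theorem no_sfms_imp_perfect_matching:
  fixes Abar :: "bool ^ 'n ^ 'n" and Bbar :: "bool ^ 'm ^ 'n" and Cbar :: "bool ^ 'n ^ 'p"
  assumes "no_sfms Abar Bbar Cbar Kbar"
  shows "\<exists>M. perfect_matching (system_bipartite Abar Bbar Cbar Kbar) M"
proof -
  obtain A B C where A: "A \<in> realizations Abar" and B: "B \<in> realizations Bbar"
    and C: "C \<in> realizations Cbar"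
    and none: "(\<Inter>K \<in> realizations Kbar. eigenvalues (A + B ** K ** C)) = {}"
    using assms unfolding no_sfms_def by blast
  have "0 \<notin> (\<Inter>K \<in> realizations Kbar. eigenvalues (A + B ** K ** C))" unfolding none by simp
  then obtain K where K: "K \<in> realizations Kbar" and nz: "0 \<notin> eigenvalues (A + B ** K ** C)"
    unfolding INT_iff by blast
  have ker: "x = 0" if "(A + B ** K ** C) *v x = 0" for x
  proof (rule ccontr)
    assume "x \<noteq> 0"
    then have "det (A + B ** K ** C) = 0" using that det_eq_0_iff_kernel by blast
    then have "det (cmat (A + B ** K ** C)) = 0" by (simp add: det_cmat)
    then show False using nz unfolding eigenvalues_def det_eq_0_iff_kernel by auto
  qed
  define entry where "entry a b =
    (case (a, b) of (State i, State j) \<Rightarrow> A $ i $ j | (State i, Input j) \<Rightarrow> B $ i $ j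
      | (Output i, State j) \<Rightarrow> C $ i $ j | (Input i, Output j) \<Rightarrow> K $ i $ j
      | (Input i, Input j) \<Rightarrow> - of_bool (i = j) | (Output i, Output j) \<Rightarrow> - of_bool (i = j)
      | _ \<Rightarrow> 0)" for a b :: "('n, 'm, 'p) vertex"
  define F :: "real ^ ('n, 'm, 'p) vertex ^ ('n, 'm, 'p) vertex" where "F = (\<chi> a b. entry a b)"
  have entry_edge: "(a, b) \<in> system_bipartite Abar Bbar Cbar Kbar" if "entry a b \<noteq> 0" for a b
    using that A B C K
    by (cases a; cases b) (auto simp: entry_def system_bipartite_def realizations_def of_bool_def split: if_splits)
  have "det F \<noteq> 0"
  proof
    assume "det F = 0"
    then obtain v where v: "v \<noteq> 0" "F *v v = 0" using det_eq_0_iff_kernel by blast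
    define x where "x = (\<chi> i. v $ State i)"
    define u where "u = (\<chi> i. v $ Input i)"
    define y where "y = (\<chi> i. v $ Output i)"
    have delta: "(\<Sum>j\<in>UNIV. of_bool (i = j) * w j) = w i" for i :: "'k::finite" and w :: "'k \<Rightarrow> real"
      by (simp add: of_bool_def if_distrib[of "\<lambda>c. c * _"] cong: if_cong)
    have row: "(\<Sum>b\<in>UNIV. entry a b * v $ b) = 0" for a
      using arg_cong[OF v(2), of "\<lambda>w. w $ a"] by (simp add: F_def matrix_vector_mult_def)
    have "A *v x + B *v u = 0"
    proof (subst vec_eq_iff, rule allI)
      fix i show "(A *v x + B *v u) $ i = 0 $ i"
        using row[of "State i"]
        by (simp add: sum_vertex entry_def matrix_vector_mult_def x_def u_def)
    qed
    moreover have "u = K *v y"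
    proof (subst vec_eq_iff, rule allI)
      fix i show "u $ i = (K *v y) $ i"
        using row[of "Input i"]
        by (simp add: sum_vertex entry_def matrix_vector_mult_def y_def u_def delta sum_negf)
    qed
    moreover have y: "y = C *v x"
    proof (subst vec_eq_iff, rule allI)
      fix i show "y $ i = (C *v x) $ i"
        using row[of "Output i"]
        by (simp add: sum_vertex entry_def matrix_vector_mult_def y_def x_def delta sum_negf)
    qed
    ultimately have "(A + B ** K ** C) *v x = 0"
      by (simp add: matrix_vector_mult_add_rdistrib matrix_vector_mul_assoc matrix_mul_assoc)
    then have x0: "x = 0" by (rule ker)
    then have "y = 0" using y by simp
    then have "u = 0" using \<open>u = K *v y\<close> by simp
    have "v $ a = 0" for a
    proof (cases a)
      case (State i) then show ?thesis using arg_cong[OF x0, of "\<lambda>w. w $ i"] by (simp add: x_def)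
    next
      case (Input i) then show ?thesis using arg_cong[OF \<open>u = 0\<close>, of "\<lambda>w. w $ i"] by (simp add: u_def)
    next
      case (Output i) then show ?thesis using arg_cong[OF \<open>y = 0\<close>, of "\<lambda>w. w $ i"] by (simp add: y_def)
    qed
    then show False using v(1) by (simp add: vec_eq_iff)
  qed
  then obtain f where f: "f permutes UNIV" "(\<Prod>a\<in>UNIV. F $ a $ f a) \<noteq> 0"
    unfolding det_def by (metis (no_types, lifting) mem_Collect_eq mult_zero_right sum.neutral)
  have "entry a (f a) \<noteq> 0" for a
  proof -
    have "F $ a $ f a \<noteq> 0" using f(2) by (simp add: prod_zero_iff)
    then show ?thesis by (simp add: F_def)
  qed
  then have "{(a, f a) | a. True} \<subseteq> system_bipartite Abar Bbar Cbar Kbar" using entry_edge by blast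
  moreover have "inj f" using f(1) by (rule permutes_inj)
  ultimately show ?thesis unfolding perfect_matching_iff_permutation by blast
qed

section \<open>Fixed modes of an uncovered layer\<close>

text \<open>
  The characteristic polynomial \<open>h\<close> of the block must have a root: otherwise it is constant, and the
  determinant \<open>g(w)\<close> of \<open>1 - w A\<close> on the block, which is \<open>w\<^bsup>|M|\<^esup> h(1/w)\<close> for \<open>w \<noteq> 0\<close>, would vanish
  at \<open>w = 0\<close> by continuation, although \<open>g(0) = 1\<close>.
\<close>

lemma block_eigenvector:
  fixes A :: "complex ^ 'n ^ 'n"
  assumes "M \<noteq> {}"
  shows "\<exists>z v. v \<noteq> 0 \<and> (\<forall>s. s \<notin> M \<longrightarrow> v $ s = 0) \<and>
           (\<forall>r\<in>M. (\<Sum>s\<in>M. A $ r $ s * v $ s) = z * v $ r)"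
proof -
  define h where "h z = det (block_or_id M (mat z - A))" for z
  define g where "g w = det (block_or_id M (\<chi> r s. (if r = s then 1 else 0) - w * A $ r $ s))" for w
  have "poly_fun h"
    unfolding h_def
  proof (rule poly_fun_det)
    fix i j show "poly_fun (\<lambda>z. block_or_id M (mat z - A) $ i $ j)"
      by (cases "i \<in> M \<and> j \<in> M"; cases "i = j") (auto simp: block_or_id_def mat_def)
  qed
  then obtain p where p: "h = poly p" by (auto simp: poly_fun_def)
  have g_poly: "poly_fun g"
    unfolding g_def
  proof (rule poly_fun_det)
    fix i j
    have "poly_fun (\<lambda>w. c - w * A $ i $ j)" for c
      by (intro poly_fun_diff poly_fun_mult poly_fun_const poly_fun_id)
    from this[of 1] this[of 0]
    show "poly_fun (\<lambda>w. block_or_id M (\<chi> r s. (if r = s then 1 else 0) - w * A $ r $ s) $ i $ j)"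
      by (cases "i \<in> M \<and> j \<in> M"; cases "i = j") (auto simp: block_or_id_def)
  qed
  have scale: "g w = w ^ card M * h (1 / w)" if w: "w \<noteq> 0" for w
  proof -
    have "block_or_id M (\<chi> r s. (if r = s then 1 else 0) - w * A $ r $ s) =
        (\<chi> r. (if r \<in> M then w else 1) *s (block_or_id M (mat (1 / w) - A) $ r))"
      using w by (simp add: vec_eq_iff block_or_id_def mat_def field_simps)
    then have "g w = (\<Prod>r\<in>UNIV. if r \<in> M then w else 1) * det (\<chi> r. block_or_id M (mat (1 / w) - A) $ r)"
      unfolding g_def by (simp only: det_rows_mul)
    moreover have "(\<Prod>r\<in>UNIV. if r \<in> M then w else 1) = w ^ card M"
      by (simp add: prod.If_cases)
    ultimately show ?thesis by (simp add: h_def)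
  qed
  have "block_or_id M (\<chi> r s. (if r = s then 1 else 0) - 0 * A $ r $ s) = mat 1"
    by (simp add: vec_eq_iff block_or_id_def mat_def)
  then have "g 0 = det (mat 1 :: complex ^ 'n ^ 'n)" unfolding g_def by (simp only:)
  then have g0: "g 0 = 1" by (simp only: det_I)
  have "\<not> constant (poly p)"
  proof
    assume const: "constant (poly p)"
    define f where "f w = g w - w ^ card M * h 0" for w
    have pw: "poly_fun (\<lambda>w. w ^ k)" for k by (induction k) auto
    have "poly_fun f" unfolding f_def by (intro poly_fun_diff g_poly poly_fun_mult pw poly_fun_const)
    moreover have "f 0 = 1" using g0 assms by (simp add: f_def card_gt_0_iff)
    ultimately have "finite {w. f w = 0}" using poly_fun_finite_zeros[of f 0] by simp
    moreover have "- {0} \<subseteq> {w. f w = 0}"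
    proof
      fix w :: complex assume "w \<in> - {0}"
      moreover have "h (1 / w) = h 0" using const unfolding p constant_def by blast
      ultimately show "w \<in> {w. f w = 0}" using scale[of w] by (simp add: f_def)
    qed
    ultimately have "finite (- {0::complex})" using finite_subset by blast
    then show False using infinite_UNIV_char_0[where 'a = complex] by (simp add: Compl_eq_Diff_UNIV)
  qed
  then obtain z where "h z = 0" using fundamental_theorem_of_algebra p by metis
  then obtain v where v: "v \<noteq> 0" "block_or_id M (mat z - A) *v v = 0"
    unfolding h_def det_eq_0_iff_kernel by blast
  have off: "v $ s = 0" if "s \<notin> M" for s
    using arg_cong[OF v(2), of "\<lambda>u. u $ s"] that by (simp add: block_or_id_mult)
  have "(\<Sum>s\<in>M. A $ r $ s * v $ s) = z * v $ r" if r: "r \<in> M" for r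
  proof -
    have "0 = (\<Sum>s\<in>M. (mat z - A) $ r $ s * v $ s)"
      using arg_cong[OF v(2), of "\<lambda>u. u $ r"] r by (simp add: block_or_id_mult)
    also have "\<dots> = (\<Sum>s\<in>M. (if s = r then z * v $ s else 0) - A $ r $ s * v $ s)"
      by (rule sum.cong) (auto simp: mat_def algebra_simps)
    also have "\<dots> = z * v $ r - (\<Sum>s\<in>M. A $ r $ s * v $ s)"
      using r by (simp add: sum_subtractf)
    finally show ?thesis by simp
  qed
  then show ?thesis using v(1) off by blast
qed

text \<open>
  Order the states as: outside \<open>D\<close>, the layer \<open>D - R\<close>, then \<open>R\<close>. As no feedback edge leads from
  outputs of \<open>D\<close> to inputs of the complement of \<open>R\<close>, closing the loop changes only rows in \<open>R\<close> or
  columns outside \<open>D\<close>. The closed loop stays block triangular, with the block of \<open>A\<close> on the layer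
  unchanged. An eigenvector of this block is an eigenvector modulo the invariant subspace of \<open>R\<close>.
\<close>

theorem uncovered_layer_imp_sfms:
  fixes Abar :: "bool ^ 'n ^ 'n" and Bbar :: "bool ^ 'm ^ 'n" and Cbar :: "bool ^ 'n ^ 'p"
  assumes D: "\<And>r s. Abar $ r $ s \<Longrightarrow> s \<in> D \<Longrightarrow> r \<in> D"
    and R: "\<And>r s. Abar $ r $ s \<Longrightarrow> s \<in> R \<Longrightarrow> r \<in> R"
    and layer: "R \<subset> D"
    and K: "\<And>p q. Kbar $ p $ q \<Longrightarrow> (\<forall>r. Bbar $ r $ p \<longrightarrow> r \<in> R) \<or> (\<forall>r. Cbar $ q $ r \<longrightarrow> r \<notin> D)"
  shows "\<not> no_sfms Abar Bbar Cbar Kbar"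
proof
  assume "no_sfms Abar Bbar Cbar Kbar"
  then obtain A B C where A: "A \<in> realizations Abar" and B: "B \<in> realizations Bbar"
    and C: "C \<in> realizations Cbar"
    and none: "(\<Inter>K \<in> realizations Kbar. eigenvalues (A + B ** K ** C)) = {}"
    unfolding no_sfms_def by blast
  have "D - R \<noteq> {}" using layer by blast
  from block_eigenvector[OF this, of "cmat A"]
  obtain z v where v: "v \<noteq> 0" "\<forall>s. s \<notin> D - R \<longrightarrow> v $ s = 0"
    "\<forall>r\<in>D - R. (\<Sum>s\<in>D - R. cmat A $ r $ s * v $ s) = z * v $ r"
    by blast
  have "z \<in> eigenvalues (A + B ** G ** C)" if G: "G \<in> realizations Kbar" for G
  proof (rule ccontr)
    assume "z \<notin> eigenvalues (A + B ** G ** C)"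
    then have nz: "det (mat z - cmat (A + B ** G ** C)) \<noteq> 0" by (simp add: eigenvalues_iff_det)
    have BGC: "(B ** G ** C) $ r $ s = 0" if rs: "r \<notin> R" "s \<in> D" for r s
    proof -
      have "(\<Sum>p\<in>UNIV. B $ r $ p * G $ p $ q) * C $ q $ s = 0" for q
      proof (cases "C $ q $ s = 0")
        case False
        then have "Cbar $ q $ s" using C by (auto simp: realizations_def)
        have "B $ r $ p * G $ p $ q = 0" for p
        proof (cases "G $ p $ q = 0")
          case False
          then have "Kbar $ p $ q" using G by (auto simp: realizations_def)
          then have "\<not> Bbar $ r $ p" using K \<open>Cbar $ q $ s\<close> rs by blast
          then show ?thesis using B by (simp add: realizations_def)
        qed simp
        then have "(\<Sum>p\<in>UNIV. B $ r $ p * G $ p $ q) = 0" by (intro sum.neutral) blast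
        then show ?thesis by simp
      qed simp
      then have "(\<Sum>q\<in>UNIV. (\<Sum>p\<in>UNIV. B $ r $ p * G $ p $ q) * C $ q $ s) = 0"
        by (intro sum.neutral) blast
      then show ?thesis by (simp add: matrix_matrix_mult_def)
    qed
    have entry: "cmat (A + B ** G ** C) $ r $ s = cmat A $ r $ s" if "r \<notin> R" "s \<in> D" for r s
      using BGC[OF that] by simp
    have A0: "A $ r $ s = 0" if "r \<notin> D" "s \<in> D" for r s
      using that D A by (auto simp: realizations_def)
    have A0': "A $ r $ s = 0" if "r \<notin> R" "s \<in> R" for r s
      using that R A by (auto simp: realizations_def)
    define w where "w = (mat z - cmat (A + B ** G ** C)) *v v"
    have w0: "w $ r = 0" if r: "r \<notin> R" for r
    proof -
      have "(cmat (A + B ** G ** C) *v v) $ r = (\<Sum>s\<in>D - R. cmat (A + B ** G ** C) $ r $ s * v $ s)"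
        by (rule mult_supported) (use v(2) in blast)
      also have "\<dots> = (\<Sum>s\<in>D - R. cmat A $ r $ s * v $ s)"
        by (rule sum.cong) (use entry[OF r] in auto)
      also have "\<dots> = z * v $ r"
      proof (cases "r \<in> D")
        case False
        then show ?thesis using A0 v(2) by simp
      qed (use r v(3) in blast)
      finally show ?thesis unfolding w_def mat_diff_mult_vector by simp
    qed
    have "(mat z - cmat (A + B ** G ** C)) $ r $ s = 0" if "r \<notin> R" "s \<in> R" for r s
    proof -
      have "r \<noteq> s" "s \<in> D" using that layer by auto
      then show ?thesis using A0'[OF that] BGC[OF that(1)] by (simp add: mat_def)
    qed
    then obtain y where y: "(mat z - cmat (A + B ** G ** C)) *v y = w" "\<And>s. s \<notin> R \<Longrightarrow> y $ s = 0"
      using solvable_in_invariant_subspace[OF nz] w0 by blast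
    have "(mat z - cmat (A + B ** G ** C)) *v (y - v) = 0"
      using y(1) unfolding w_def by (simp add: matrix_vector_mult_diff_distrib)
    then have "y - v = 0" using nz det_eq_0_iff_kernel by blast
    then have "v $ s = 0" for s using y(2)[of s] v(2) by (cases "s \<in> R") auto
    then show False using v(1) by (simp add: vec_eq_iff)
  qed
  then show False using none by blast
qed

section \<open>Fixed modes when the components form a line\<close>

lemma arcs_ends_state_digraph: "arcs_ends (state_digraph Abar) = influences Abar"
  by (auto simp: arcs_ends_conv state_digraph_def influences_def)

lemma reachable_state_digraph:
  "u \<rightarrow>\<^sup>*\<^bsub>state_digraph Abar\<^esub> v \<longleftrightarrow> (u, v) \<in> (influences Abar)\<^sup>*"
proof -
  have "(u, v) \<in> rtrancl_on UNIV R \<longleftrightarrow> (u, v) \<in> R\<^sup>*" for R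
  proof
    show "(u, v) \<in> R\<^sup>*" if "(u, v) \<in> rtrancl_on UNIV R"
      using that by (induction rule: rtrancl_on_induct) auto
    show "(u, v) \<in> rtrancl_on UNIV R" if "(u, v) \<in> R\<^sup>*"
      using that by (induction rule: rtrancl_induct) (auto intro: rtrancl_on_into_rtrancl_on)
  qed
  then show ?thesis
    unfolding reachable_def arcs_ends_state_digraph by (simp add: state_digraph_def)
qed

lemma mem_sccs_state_digraph:
  "S \<in> pre_digraph.sccs_verts (state_digraph Abar) \<longleftrightarrow>
     S \<noteq> {} \<and> (\<forall>u\<in>S. \<forall>v\<in>S. (u, v) \<in> (influences Abar)\<^sup>*) \<and>
     (\<forall>u\<in>S. \<forall>v. v \<notin> S \<longrightarrow> (u, v) \<notin> (influences Abar)\<^sup>* \<or> (v, u) \<notin> (influences Abar)\<^sup>*)"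
  by (simp add: pre_digraph.sccs_verts_def reachable_state_digraph)

lemma arcs_ends_scc_dag:
  "arcs_ends (scc_dag G) = {(S, T). S \<in> pre_digraph.sccs_verts G \<and> T \<in> pre_digraph.sccs_verts G \<and>
     S \<noteq> T \<and> (\<exists>u\<in>S. \<exists>v\<in>T. (u, v) \<in> arcs_ends G)}"
proof -
  have "arcs_ends (scc_dag G) = (\<lambda>e. (fst e, snd e)) ` arcs (scc_dag G)"
    by (simp add: arcs_ends_conv scc_dag_def)
  then show ?thesis by (simp add: scc_dag_def)
qed

text \<open>
  Along a line of components, reachability between states is just the order of the component
  numbers, counted from 0 like the positions in \<open>Cs\<close>.
\<close>

lemma line_graph_index:
  fixes Abar :: "bool ^ 'n ^ 'n"
  assumes line: "line_graph (scc_dag (state_digraph Abar)) Cs"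
  obtains idx where
    "\<And>x. idx x < length Cs"
    "\<And>k x. k < length Cs \<Longrightarrow> x \<in> Cs ! k \<longleftrightarrow> k = idx x"
    "\<And>k. k < length Cs \<Longrightarrow> \<exists>x. idx x = k"
    "\<And>r s. Abar $ r $ s \<Longrightarrow> idx s \<le> idx r"
    "\<And>x y. idx x \<le> idx y \<Longrightarrow> (x, y) \<in> (influences Abar)\<^sup>*"
proof -
  let ?R = "(influences Abar)\<^sup>*"
  let ?scc = "pre_digraph.sccs_verts (state_digraph Abar)"
  have dist: "distinct Cs" and set: "set Cs = ?scc"
    and arcs: "{(S, T). S \<in> ?scc \<and> T \<in> ?scc \<and> S \<noteq> T \<and> (\<exists>u\<in>S. \<exists>v\<in>T. (u, v) \<in> influences Abar)} =
                 {(Cs ! k, Cs ! Suc k) | k. Suc k < length Cs}"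
  proof -
    have verts: "verts (scc_dag (state_digraph Abar)) = ?scc" by (simp add: scc_dag_def)
    have L: "distinct Cs \<and> ?scc = set Cs \<and>
        arcs_ends (scc_dag (state_digraph Abar)) = {(Cs ! k, Cs ! Suc k) | k. Suc k < length Cs}"
      using line unfolding line_graph_def verts .
    show "distinct Cs" using L by (rule conjunct1)
    show "set Cs = ?scc" using L by (elim conjE) (rule sym)
    show "{(S, T). S \<in> ?scc \<and> T \<in> ?scc \<and> S \<noteq> T \<and> (\<exists>u\<in>S. \<exists>v\<in>T. (u, v) \<in> influences Abar)} =
            {(Cs ! k, Cs ! Suc k) | k. Suc k < length Cs}"
      using L unfolding arcs_ends_scc_dag arcs_ends_state_digraph by (elim conjE)
  qed
  have ex: "\<exists>k<length Cs. x \<in> Cs ! k" for x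
  proof -
    have "{v. (x, v) \<in> ?R \<and> (v, x) \<in> ?R} \<in> ?scc"
      unfolding mem_sccs_state_digraph by (blast intro: rtrancl_trans)
    then have "{v. (x, v) \<in> ?R \<and> (v, x) \<in> ?R} \<in> set Cs" using set by simp
    then obtain k where "k < length Cs" "Cs ! k = {v. (x, v) \<in> ?R \<and> (v, x) \<in> ?R}"
      by (auto simp: in_set_conv_nth)
    then show ?thesis by auto
  qed
  have scc: "Cs ! k \<in> ?scc" if "k < length Cs" for k using that set nth_mem by blast
  have uniq: "k = l" if k: "k < length Cs" "x \<in> Cs ! k" and l: "l < length Cs" "x \<in> Cs ! l" for k l x
  proof -
    have "S \<subseteq> T" if "S \<in> ?scc" "T \<in> ?scc" "x \<in> S" "x \<in> T" for S T
      using that unfolding mem_sccs_state_digraph by blast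
    then have "Cs ! k = Cs ! l" using scc[OF k(1)] scc[OF l(1)] k(2) l(2) by (meson subset_antisym)
    then show ?thesis using dist k(1) l(1) nth_eq_iff_index_eq by blast
  qed
  obtain idx where idx: "\<And>x. idx x < length Cs" "\<And>x. x \<in> Cs ! idx x" using ex by metis
  have mem: "x \<in> Cs ! k \<longleftrightarrow> k = idx x" if "k < length Cs" for k x
    using that uniq idx by blast
  have surj: "\<exists>x. idx x = k" if "k < length Cs" for k
  proof -
    have "Cs ! k \<noteq> {}" using scc[OF that] unfolding mem_sccs_state_digraph by blast
    then obtain x where "x \<in> Cs ! k" by blast
    then have "k = idx x" using mem[OF that] by simp
    then show ?thesis by blast
  qed
  have edge: "idx s \<le> idx r" if "Abar $ r $ s" for r s
  proof (cases "idx s = idx r")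
    case False
    then have "Cs ! idx s \<noteq> Cs ! idx r" using dist idx(1) nth_eq_iff_index_eq by blast
    moreover have "(s, r) \<in> influences Abar" using that by (simp add: influences_def)
    ultimately have "(Cs ! idx s, Cs ! idx r) \<in> {(S, T). S \<in> ?scc \<and> T \<in> ?scc \<and> S \<noteq> T \<and>
        (\<exists>u\<in>S. \<exists>v\<in>T. (u, v) \<in> influences Abar)}"
      using scc idx by blast
    then obtain k where "Suc k < length Cs" "Cs ! idx s = Cs ! k" "Cs ! idx r = Cs ! Suc k"
      unfolding arcs by auto
    then have "idx s = k" "idx r = Suc k" using dist idx(1) nth_eq_iff_index_eq Suc_lessD by metis+
    then show ?thesis by simp
  qed simp
  have same: "(x, y) \<in> ?R" if "idx x = idx y" for x y
    using scc[OF idx(1)[of x]] idx(2)[of x] idx(2)[of y] that unfolding mem_sccs_state_digraph by simp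
  have reach: "idx x + d = idx y \<Longrightarrow> (x, y) \<in> ?R" for d x y
  proof (induction d arbitrary: y)
    case 0
    then show ?case using same by simp
  next
    case (Suc d)
    have k: "Suc (idx x + d) < length Cs" using Suc.prems idx(1)[of y] by simp
    then have "(Cs ! (idx x + d), Cs ! Suc (idx x + d)) \<in> {(Cs ! k, Cs ! Suc k) | k. Suc k < length Cs}"
      by blast
    then obtain u v where uv: "u \<in> Cs ! (idx x + d)" "v \<in> Cs ! Suc (idx x + d)" "(u, v) \<in> influences Abar"
      unfolding arcs[symmetric] by blast
    have "idx u = idx x + d" using uv(1) mem k by (metis Suc_lessD)
    then have xu: "(x, u) \<in> ?R" using Suc.IH by simp
    have "idx v = idx y" using uv(2) mem[OF k] Suc.prems by simp
    then have "(v, y) \<in> ?R" using same by simp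
    then show ?case using xu uv(3) by (meson rtrancl.rtrancl_into_rtrancl rtrancl_trans)
  qed
  have "(x, y) \<in> ?R" if "idx x \<le> idx y" for x y
    using reach[of x "idx y - idx x" y] that by simp
  with idx(1) mem surj edge show ?thesis using that by blast
qed

text \<open>
  The layer of component \<open>k\<close> is the difference of the two successor-closed sets of states with
  component number at least \<open>k\<close> and greater than \<open>k\<close>; a feedback edge spans it iff it is a
  candidate edge, the index of \<^const>\<open>candidate_edges\<close> being one larger than the position in the list.
\<close>

lemma no_sfms_iff_candidate_cover:
  fixes Abar :: "bool ^ 'n ^ 'n" and Bbar :: "bool ^ 'm ^ 'n" and Cbar :: "bool ^ 'n ^ 'p"
  assumes line: "line_graph (scc_dag (state_digraph Abar)) Cs"
  shows "no_sfms Abar Bbar Cbar Kbar \<longleftrightarrow>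
     (\<forall>k \<in> {1..length Cs}. {(j, i). Kbar $ i $ j} \<inter> candidate_edges Bbar Cbar Cs k \<noteq> {}) \<and>
     (\<exists>M. perfect_matching (system_bipartite Abar Bbar Cbar Kbar) M)"
proof -
  obtain idx where idx: "\<And>x. idx x < length Cs"
    and mem: "\<And>k x. k < length Cs \<Longrightarrow> x \<in> Cs ! k \<longleftrightarrow> k = idx x"
    and surj: "\<And>k. k < length Cs \<Longrightarrow> \<exists>x. idx x = k"
    and edge: "\<And>r s. Abar $ r $ s \<Longrightarrow> idx s \<le> idx r"
    and reach: "\<And>x y. idx x \<le> idx y \<Longrightarrow> (x, y) \<in> (influences Abar)\<^sup>*"
    using line_graph_index[OF line] by blast
  have up: "i \<in> upstream_inputs Bbar Cs (Suc k) \<longleftrightarrow> (\<exists>r. Bbar $ r $ i \<and> idx r \<le> k)"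
    if "k < length Cs" for i k
  proof -
    have "i \<in> upstream_inputs Bbar Cs (Suc k) \<longleftrightarrow> (\<exists>q \<in> {1..Suc k}. \<exists>r. r \<in> Cs ! (q - 1) \<and> Bbar $ r $ i)"
      by (auto simp: upstream_inputs_def component_inputs_def)
    also have "\<dots> \<longleftrightarrow> (\<exists>q \<in> {1..Suc k}. \<exists>r. q - 1 = idx r \<and> Bbar $ r $ i)"
      by (intro bex_cong refl) (use mem that in auto)
    also have "\<dots> \<longleftrightarrow> (\<exists>r. Bbar $ r $ i \<and> idx r \<le> k)"
    proof
      assume "\<exists>r. Bbar $ r $ i \<and> idx r \<le> k"
      then obtain r where "Bbar $ r $ i" "idx r \<le> k" by blast
      then show "\<exists>q \<in> {1..Suc k}. \<exists>r. q - 1 = idx r \<and> Bbar $ r $ i"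
        by (intro bexI[of _ "Suc (idx r)"]) auto
    next
      assume "\<exists>q \<in> {1..Suc k}. \<exists>r. q - 1 = idx r \<and> Bbar $ r $ i"
      then obtain q r where "q \<in> {1..Suc k}" "q - 1 = idx r" "Bbar $ r $ i" by blast
      then show "\<exists>r. Bbar $ r $ i \<and> idx r \<le> k" by (intro exI[of _ r]) auto
    qed
    finally show ?thesis .
  qed
  have down: "j \<in> downstream_outputs Cbar Cs (Suc k) \<longleftrightarrow> (\<exists>r. Cbar $ j $ r \<and> k \<le> idx r)"
    if "k < length Cs" for j k
  proof -
    have "j \<in> downstream_outputs Cbar Cs (Suc k) \<longleftrightarrow>
        (\<exists>q \<in> {Suc k..length Cs}. \<exists>r. r \<in> Cs ! (q - 1) \<and> Cbar $ j $ r)"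
      by (auto simp: downstream_outputs_def component_outputs_def)
    also have "\<dots> \<longleftrightarrow> (\<exists>q \<in> {Suc k..length Cs}. \<exists>r. q - 1 = idx r \<and> Cbar $ j $ r)"
      by (intro bex_cong refl) (use mem that in auto)
    also have "\<dots> \<longleftrightarrow> (\<exists>r. Cbar $ j $ r \<and> k \<le> idx r)"
    proof
      assume "\<exists>r. Cbar $ j $ r \<and> k \<le> idx r"
      then obtain r where "Cbar $ j $ r" "k \<le> idx r" by blast
      then show "\<exists>q \<in> {Suc k..length Cs}. \<exists>r. q - 1 = idx r \<and> Cbar $ j $ r"
        using idx[of r] by (intro bexI[of _ "Suc (idx r)"]) auto
    next
      assume "\<exists>q \<in> {Suc k..length Cs}. \<exists>r. q - 1 = idx r \<and> Cbar $ j $ r"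
      then obtain q r where "q \<in> {Suc k..length Cs}" "q - 1 = idx r" "Cbar $ j $ r" by blast
      then show "\<exists>r. Cbar $ j $ r \<and> k \<le> idx r" by (intro exI[of _ r]) auto
    qed
    finally show ?thesis .
  qed
  have cand: "{(j, i). Kbar $ i $ j} \<inter> candidate_edges Bbar Cbar Cs (Suc k) \<noteq> {} \<longleftrightarrow>
      (\<exists>p q. Kbar $ p $ q \<and> (\<exists>r. Bbar $ r $ p \<and> idx r \<le> k) \<and> (\<exists>r. Cbar $ q $ r \<and> k \<le> idx r))"
    if "k < length Cs" for k
  proof -
    have "{(j, i). Kbar $ i $ j} \<inter> candidate_edges Bbar Cbar Cs (Suc k) \<noteq> {} \<longleftrightarrow>
        (\<exists>p q. Kbar $ p $ q \<and> p \<in> upstream_inputs Bbar Cs (Suc k) \<and> q \<in> downstream_outputs Cbar Cs (Suc k))"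
      unfolding candidate_edges_def by blast
    then show ?thesis unfolding up[OF that] down[OF that] .
  qed
  have shift: "(\<forall>k \<in> {1..length Cs}. Q k) \<longleftrightarrow> (\<forall>k < length Cs. Q (Suc k))" for Q
  proof
    assume *: "\<forall>k < length Cs. Q (Suc k)"
    show "\<forall>k \<in> {1..length Cs}. Q k"
    proof
      fix k assume "k \<in> {1..length Cs}"
      then show "Q k" using *[rule_format, of "k - 1"] by auto
    qed
  qed auto
  show ?thesis
  proof
    assume ns: "no_sfms Abar Bbar Cbar Kbar"
    have "\<exists>p q. Kbar $ p $ q \<and> (\<exists>r. Bbar $ r $ p \<and> idx r \<le> k) \<and> (\<exists>r. Cbar $ q $ r \<and> k \<le> idx r)"
      if k: "k < length Cs" for k
    proof (rule ccontr)
      assume none: "\<not> ?thesis"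
      have "\<not> no_sfms Abar Bbar Cbar Kbar"
      proof (rule uncovered_layer_imp_sfms[of _ "{x. k \<le> idx x}" "{x. k < idx x}"])
        show "{x. k < idx x} \<subset> {x. k \<le> idx x}" using surj[OF k] by force
        show "r \<in> {x. k \<le> idx x}" if "Abar $ r $ s" "s \<in> {x. k \<le> idx x}" for r s
          using that edge[of r s] by auto
        show "r \<in> {x. k < idx x}" if "Abar $ r $ s" "s \<in> {x. k < idx x}" for r s
          using that edge[of r s] by auto
        show "(\<forall>r. Bbar $ r $ p \<longrightarrow> r \<in> {x. k < idx x}) \<or> (\<forall>r. Cbar $ q $ r \<longrightarrow> r \<notin> {x. k \<le> idx x})"
          if "Kbar $ p $ q" for p q
          using that none by (auto simp: not_le not_less)
      qed
      then show False using ns by blast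
    qed
    then have "\<forall>k \<in> {1..length Cs}. {(j, i). Kbar $ i $ j} \<inter> candidate_edges Bbar Cbar Cs k \<noteq> {}"
      unfolding shift using cand by blast
    then show "(\<forall>k \<in> {1..length Cs}. {(j, i). Kbar $ i $ j} \<inter> candidate_edges Bbar Cbar Cs k \<noteq> {}) \<and>
        (\<exists>M. perfect_matching (system_bipartite Abar Bbar Cbar Kbar) M)"
      using no_sfms_imp_perfect_matching[OF ns] by blast
  next
    assume h: "(\<forall>k \<in> {1..length Cs}. {(j, i). Kbar $ i $ j} \<inter> candidate_edges Bbar Cbar Cs k \<noteq> {}) \<and>
        (\<exists>M. perfect_matching (system_bipartite Abar Bbar Cbar Kbar) M)"
    from h[THEN conjunct2] obtain M where M: "perfect_matching (system_bipartite Abar Bbar Cbar Kbar) M"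
      by (rule exE)
    have cov: "\<exists>p q. Kbar $ p $ q \<and> (\<exists>r. Bbar $ r $ p \<and> idx r \<le> k) \<and> (\<exists>r. Cbar $ q $ r \<and> k \<le> idx r)"
      if "k < length Cs" for k
      using h[THEN conjunct1, unfolded shift, THEN spec, THEN mp, OF that] unfolding cand[OF that] .
    show "no_sfms Abar Bbar Cbar Kbar"
    proof (rule no_sfms_sufficient[OF _ M])
      fix x
      show "\<exists>p q. Kbar $ p $ q \<and> (\<exists>r. Bbar $ r $ p \<and> (r, x) \<in> (influences Abar)\<^sup>*) \<and>
                                  (\<exists>r. Cbar $ q $ r \<and> (x, r) \<in> (influences Abar)\<^sup>*)"
        using cov[OF idx[of x]] reach by blast
    qed
  qed
qed

section \<open>Interval covers and the dynamic program\<close>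

lemma first_component_props:
  assumes "v \<in> upstream_inputs Bbar Cs k"
  shows "v \<in> upstream_inputs Bbar Cs (first_component Bbar Cs v)"
    "1 \<le> first_component Bbar Cs v" "first_component Bbar Cs v \<le> k"
    "q < first_component Bbar Cs v \<Longrightarrow> v \<notin> upstream_inputs Bbar Cs q"
proof -
  show 1: "v \<in> upstream_inputs Bbar Cs (first_component Bbar Cs v)"
    unfolding first_component_def using assms by (rule LeastI[where P = "\<lambda>q. v \<in> upstream_inputs Bbar Cs q"])
  show "1 \<le> first_component Bbar Cs v"
    using 1 by (cases "first_component Bbar Cs v") (auto simp: upstream_inputs_def)
  show "first_component Bbar Cs v \<le> k"
    unfolding first_component_def using assms by (rule Least_le[where P = "\<lambda>q. v \<in> upstream_inputs Bbar Cs q"])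
  show "v \<notin> upstream_inputs Bbar Cs q" if "q < first_component Bbar Cs v"
    using that unfolding first_component_def by (rule not_less_Least[where P = "\<lambda>q. v \<in> upstream_inputs Bbar Cs q"])
qed

lemma upstream_inputs_mono: "a \<le> b \<Longrightarrow> upstream_inputs Bbar Cs a \<subseteq> upstream_inputs Bbar Cs b"
  unfolding upstream_inputs_def by (rule UN_mono) auto

lemma downstream_outputs_antimono:
  "a \<le> b \<Longrightarrow> downstream_outputs Cbar Cs b \<subseteq> downstream_outputs Cbar Cs a"
  unfolding downstream_outputs_def by (rule UN_mono) auto

text \<open>
  The interval property: an edge is a candidate at all indices from the first component that its
  input drives up to any index where it is a candidate.
\<close>

lemma candidate_edge_covers:
  assumes "(w, v) \<in> candidate_edges Bbar Cbar Cs k" "first_component Bbar Cs v \<le> q" "q \<le> k"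
  shows "(w, v) \<in> candidate_edges Bbar Cbar Cs q"
proof -
  have v: "v \<in> upstream_inputs Bbar Cs k" and w: "w \<in> downstream_outputs Cbar Cs k"
    using assms(1) by (auto simp: candidate_edges_def)
  have "v \<in> upstream_inputs Bbar Cs q"
    using first_component_props(1)[OF v] upstream_inputs_mono[OF assms(2)] by blast
  then show ?thesis
    using downstream_outputs_antimono[OF assms(3)] w by (auto simp: candidate_edges_def)
qed

text \<open>
  The feedback cost for edges written as (output, input), the orientation used by the dynamic program.
\<close>

definition edges_cost :: "ereal ^ 'p ^ 'm \<Rightarrow> ('p \<times> 'm) set \<Rightarrow> ereal" where
  "edges_cost P F = (\<Sum>(j, i)\<in>F. P $ i $ j)"

lemma feedback_cost_edges: "feedback_cost P K = edges_cost P {(j, i). K $ i $ j}"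
  unfolding feedback_cost_def edges_cost_def
  by (rule sum.reindex_bij_witness[of _ prod.swap prod.swap]) auto

lemma edges_cost_nonneg: "(\<And>i j. 0 \<le> P $ i $ j) \<Longrightarrow> 0 \<le> edges_cost P F"
  unfolding edges_cost_def by (rule sum_nonneg) auto

lemma edges_cost_Un_le:
  fixes P :: "ereal ^ 'p ^ 'm"
  assumes "\<And>i j. 0 \<le> P $ i $ j"
  shows "edges_cost P (F \<union> G) \<le> edges_cost P F + edges_cost P G"
proof -
  have "edges_cost P (F \<union> G) = edges_cost P F + edges_cost P (G - F)"
    unfolding edges_cost_def by (subst sum.union_disjoint[symmetric]) (auto intro: sum.cong)
  also have "edges_cost P (G - F) \<le> edges_cost P G"
    unfolding edges_cost_def by (rule sum_mono2) (auto simp: assms)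
  finally show ?thesis by (simp add: add_left_mono)
qed

lemma dp_run_step:
  assumes "dp_run Bbar Cbar P Cs W S" "1 \<le> k" "k \<le> length Cs"
  obtains w v where "(w, v) \<in> candidate_edges Bbar Cbar Cs k"
    "W k = P $ v $ w + W (first_component Bbar Cs v - 1)"
    "S k = insert (w, v) (S (first_component Bbar Cs v - 1))"
proof -
  have "k \<in> {1..length Cs}" using assms(2,3) by simp
  then have "\<exists>(w, v) \<in> candidate_edges Bbar Cbar Cs k.
           W k = P $ v $ w + W (first_component Bbar Cs v - 1) \<and>
           S k = {(w, v)} \<union> S (first_component Bbar Cs v - 1)"
    using assms(1) unfolding dp_run_def by blast
  then show ?thesis using that by auto
qed

lemma dp_run_covers:
  assumes run: "dp_run Bbar Cbar P Cs W S" and "k \<le> length Cs" "q \<in> {1..k}"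
  shows "S k \<inter> candidate_edges Bbar Cbar Cs q \<noteq> {}"
  using assms(2,3)
proof (induction k rule: less_induct)
  case (less k)
  then have "1 \<le> k" by simp
  then obtain w v where wv: "(w, v) \<in> candidate_edges Bbar Cbar Cs k"
    and S: "S k = insert (w, v) (S (first_component Bbar Cs v - 1))"
    using dp_run_step[OF run _ less.prems(1)] by metis
  have t: "1 \<le> first_component Bbar Cs v" "first_component Bbar Cs v \<le> k"
    using wv first_component_props[of v Bbar Cs k] by (auto simp: candidate_edges_def)
  show ?case
  proof (cases "first_component Bbar Cs v \<le> q")
    case True
    then have "(w, v) \<in> candidate_edges Bbar Cbar Cs q"
      using candidate_edge_covers[OF wv] less.prems(2) by simp
    then show ?thesis using S by blast
  next
    case False
    then have "S (first_component Bbar Cs v - 1) \<inter> candidate_edges Bbar Cbar Cs q \<noteq> {}"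
      using t less.prems by (intro less.IH) auto
    then show ?thesis using S by blast
  qed
qed

text \<open>
  Only an inequality, since an edge may be chosen in several steps, and \<open>W\<close> then counts it more
  than once.
\<close>

lemma dp_run_cost_le:
  fixes P :: "ereal ^ 'p ^ 'm"
  assumes nonneg: "\<And>i j. 0 \<le> P $ i $ j" and run: "dp_run Bbar Cbar P Cs W S" and "k \<le> length Cs"
  shows "edges_cost P (S k) \<le> W k"
  using assms(3)
proof (induction k rule: less_induct)
  case (less k)
  show ?case
  proof (cases "k = 0")
    case True
    then show ?thesis using run by (simp add: dp_run_def edges_cost_def)
  next
    case False
    then obtain w v where wv: "(w, v) \<in> candidate_edges Bbar Cbar Cs k"
      and W: "W k = P $ v $ w + W (first_component Bbar Cs v - 1)"
      and S: "S k = {(w, v)} \<union> S (first_component Bbar Cs v - 1)"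
      using dp_run_step[OF run _ less.prems] by (metis One_nat_def Suc_leI insert_is_Un neq0_conv)
    have t: "1 \<le> first_component Bbar Cs v" "first_component Bbar Cs v \<le> k"
      using wv first_component_props[of v Bbar Cs k] by (auto simp: candidate_edges_def)
    have "edges_cost P (S k) \<le> edges_cost P {(w, v)} + edges_cost P (S (first_component Bbar Cs v - 1))"
      unfolding S by (rule edges_cost_Un_le[OF nonneg])
    also have "\<dots> \<le> P $ v $ w + W (first_component Bbar Cs v - 1)"
      using less.IH[of "first_component Bbar Cs v - 1"] t less.prems
      by (simp add: edges_cost_def add_left_mono)
    finally show ?thesis by (simp add: W)
  qed
qed

text \<open>
  Optimality of the recursion. In a cover \<open>F\<close> of \<open>1..k\<close> pick an edge covering \<open>k\<close>. It covers nothing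
  before its first component \<open>t\<close>, so the remaining edges of \<open>F\<close> cover \<open>1..t-1\<close>.
\<close>

lemma dp_run_le_cover_cost:
  fixes P :: "ereal ^ 'p ^ 'm"
  assumes nonneg: "\<And>i j. 0 \<le> P $ i $ j" and run: "dp_run Bbar Cbar P Cs W S"
    and "k \<le> length Cs" and "\<And>q. q \<in> {1..k} \<Longrightarrow> F \<inter> candidate_edges Bbar Cbar Cs q \<noteq> {}"
  shows "W k \<le> edges_cost P F"
  using assms(3,4)
proof (induction k arbitrary: F rule: less_induct)
  case (less k)
  show ?case
  proof (cases "k = 0")
    case True
    then show ?thesis using run edges_cost_nonneg[OF nonneg] by (simp add: dp_run_def)
  next
    case False
    then obtain w v where wv: "(w, v) \<in> F" "(w, v) \<in> candidate_edges Bbar Cbar Cs k"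
      using less.prems(2)[of k] by auto
    define t where "t = first_component Bbar Cs v"
    have v: "v \<in> upstream_inputs Bbar Cs k" using wv by (auto simp: candidate_edges_def)
    have t: "1 \<le> t" "t \<le> k" using first_component_props[OF v] by (auto simp: t_def)
    have "W k = Min ((\<lambda>(j, i). P $ i $ j + W (first_component Bbar Cs i - 1)) `
                     candidate_edges Bbar Cbar Cs k)"
      using run False less.prems(1) by (auto simp: dp_run_def)
    also have "\<dots> \<le> P $ v $ w + W (t - 1)"
      by (rule Min_le) (use wv in \<open>auto simp: t_def intro!: image_eqI\<close>)
    also have "W (t - 1) \<le> edges_cost P (F - {(w, v)})"
    proof (rule less.IH)
      show "t - 1 < k" "t - 1 \<le> length Cs" using t less.prems(1) by auto
      fix q assume q: "q \<in> {1..t - 1}"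
      then have "v \<notin> upstream_inputs Bbar Cs q"
        using t by (intro first_component_props(4)[OF v]) (auto simp: t_def)
      then have "(w, v) \<notin> candidate_edges Bbar Cbar Cs q" by (simp add: candidate_edges_def)
      moreover have "F \<inter> candidate_edges Bbar Cbar Cs q \<noteq> {}" using q t by (intro less.prems(2)) auto
      ultimately show "(F - {(w, v)}) \<inter> candidate_edges Bbar Cbar Cs q \<noteq> {}" by blast
    qed
    also have "P $ v $ w + edges_cost P (F - {(w, v)}) = edges_cost P F"
      unfolding edges_cost_def by (subst sum.remove[OF _ wv(1)]) auto
    finally show ?thesis by (simp add: add_left_mono)
  qed
qed

text \<open>
  Each step refers to strictly smaller indices only, so a run can be built by extending both tables
  by one entry at a time.
\<close>

lemma dp_run_exists:
  fixes P :: "ereal ^ 'p ^ 'm"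
  assumes ne: "\<And>k. k \<in> {1..length Cs} \<Longrightarrow> candidate_edges Bbar Cbar Cs k \<noteq> {}"
  shows "\<exists>W S. dp_run Bbar Cbar P Cs W S"
proof -
  define step where "step W S k \<longleftrightarrow>
    W k = Min ((\<lambda>(j, i). P $ i $ j + W (first_component Bbar Cs i - 1)) ` candidate_edges Bbar Cbar Cs k) \<and>
    (\<exists>(w, v) \<in> candidate_edges Bbar Cbar Cs k.
       W k = P $ v $ w + W (first_component Bbar Cs v - 1) \<and>
       S k = {(w, v)} \<union> S (first_component Bbar Cs v - 1))"
    for W :: "nat \<Rightarrow> ereal" and S :: "nat \<Rightarrow> ('p \<times> 'm) set" and k
  have first: "first_component Bbar Cs v - 1 < k" if "(w, v) \<in> candidate_edges Bbar Cbar Cs k" for w v k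
    using that first_component_props[of v Bbar Cs k] by (auto simp: candidate_edges_def)
  have agree: "step W' S' k" if st: "step W S k" and eq: "\<And>q. q \<le> k \<Longrightarrow> W' q = W q" "\<And>q. q \<le> k \<Longrightarrow> S' q = S q"
    for W S W' S' k
  proof -
    have e: "W' (first_component Bbar Cs v - 1) = W (first_component Bbar Cs v - 1)"
      "S' (first_component Bbar Cs v - 1) = S (first_component Bbar Cs v - 1)"
      if "(w, v) \<in> candidate_edges Bbar Cbar Cs k" for w v
      using eq first[OF that] by auto
    have "(\<lambda>(j, i). P $ i $ j + W' (first_component Bbar Cs i - 1)) ` candidate_edges Bbar Cbar Cs k =
          (\<lambda>(j, i). P $ i $ j + W (first_component Bbar Cs i - 1)) ` candidate_edges Bbar Cbar Cs k"
    proof (rule image_cong[OF refl])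
      fix x assume x: "x \<in> candidate_edges Bbar Cbar Cs k"
      show "(case x of (j, i) \<Rightarrow> P $ i $ j + W' (first_component Bbar Cs i - 1)) =
          (case x of (j, i) \<Rightarrow> P $ i $ j + W (first_component Bbar Cs i - 1))"
        using x e[of "fst x" "snd x"] by (cases x) (simp only: prod.case fst_conv snd_conv)
    qed
    moreover obtain w v where wv: "(w, v) \<in> candidate_edges Bbar Cbar Cs k"
      "W k = P $ v $ w + W (first_component Bbar Cs v - 1)"
      "S k = {(w, v)} \<union> S (first_component Bbar Cs v - 1)" using st unfolding step_def by auto
    ultimately show ?thesis
      unfolding step_def using st eq(1)[of k] eq(2)[of k] e[OF wv(1)]
      by (auto simp: step_def intro!: bexI[OF _ wv(1)])
  qed
  have "\<exists>W S. W 0 = 0 \<and> S 0 = {} \<and> (\<forall>k \<in> {1..N}. step W S k)" if "N \<le> length Cs" for N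
    using that
  proof (induction N)
    case 0
    show ?case by (rule exI[of _ "\<lambda>_. 0"], rule exI[of _ "\<lambda>_. {}"]) simp
  next
    case (Suc N)
    then obtain W S where WS: "W 0 = 0" "S 0 = {}" "\<And>k. k \<in> {1..N} \<Longrightarrow> step W S k" by auto
    let ?g = "\<lambda>(j, i). P $ i $ j + W (first_component Bbar Cs i - 1)"
    let ?E = "candidate_edges Bbar Cbar Cs (Suc N)"
    have "Min (?g ` ?E) \<in> ?g ` ?E" using ne[of "Suc N"] Suc.prems by (intro Min_in) auto
    then obtain w v where wv: "(w, v) \<in> ?E" "Min (?g ` ?E) = P $ v $ w + W (first_component Bbar Cs v - 1)"
      by auto
    define W' where "W' = W(Suc N := Min (?g ` ?E))"
    define S' where "S' = S(Suc N := {(w, v)} \<union> S (first_component Bbar Cs v - 1))"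
    have e: "W' (first_component Bbar Cs i - 1) = W (first_component Bbar Cs i - 1)"
      "S' (first_component Bbar Cs i - 1) = S (first_component Bbar Cs i - 1)"
      if "(j, i) \<in> ?E" for i j
      using first[OF that] by (auto simp: W'_def S'_def)
    have "(\<lambda>(j, i). P $ i $ j + W' (first_component Bbar Cs i - 1)) ` ?E = ?g ` ?E"
    proof (rule image_cong[OF refl])
      fix x assume x: "x \<in> ?E"
      show "(case x of (j, i) \<Rightarrow> P $ i $ j + W' (first_component Bbar Cs i - 1)) = ?g x"
        using x e[of "fst x" "snd x"] by (cases x) (simp only: prod.case fst_conv snd_conv)
    qed
    moreover have "W' (Suc N) = Min (?g ` ?E)" "S' (Suc N) = {(w, v)} \<union> S (first_component Bbar Cs v - 1)"
      by (simp_all add: W'_def S'_def)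
    ultimately have "step W' S' (Suc N)"
      unfolding step_def using wv e[OF wv(1)] by (auto intro!: bexI[OF _ wv(1)])
    moreover have "step W' S' k" if "k \<in> {1..N}" for k
      by (rule agree[OF WS(3)[OF that]]) (use that in \<open>auto simp: W'_def S'_def\<close>)
    ultimately have "\<forall>k \<in> {1..Suc N}. step W' S' k" by (auto simp: le_Suc_eq)
    moreover have "W' 0 = 0" "S' 0 = {}" using WS by (auto simp: W'_def S'_def)
    ultimately show ?case by blast
  qed
  then show ?thesis unfolding dp_run_def step_def by blast
qed

section \<open>Costs of matchings and the approximation guarantee\<close>

lemma system_bipartite_mono:
  assumes "\<And>i j. Kbar $ i $ j \<Longrightarrow> Kbar' $ i $ j"
  shows "system_bipartite Abar Bbar Cbar Kbar \<subseteq> system_bipartite Abar Bbar Cbar Kbar'"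
  using assms unfolding system_bipartite_def by blast

lemma perfect_matching_state_imp_system:
  assumes "perfect_matching (state_bipartite Abar) M"
  shows "\<exists>M. perfect_matching (system_bipartite Abar Bbar Cbar Kbar) M"
proof -
  obtain f where f: "inj f" "{(a, f a) | a. True} \<subseteq> state_bipartite Abar"
    using assms unfolding perfect_matching_iff_permutation by blast
  define g where "g a = (case a of State i \<Rightarrow> State (f i) | _ \<Rightarrow> a)" for a :: "('a, 'b, 'c) vertex"
  have "inj g" unfolding g_def using f(1) by (auto simp: inj_def split: vertex.splits)
  moreover have "(a, g a) \<in> system_bipartite Abar Bbar Cbar Kbar" for a
    using f(2) by (cases a) (auto simp: g_def system_bipartite_def state_bipartite_def)
  ultimately show ?thesis unfolding perfect_matching_iff_permutation by blast
qed

lemma sum_edge_cost_matching: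
  fixes P :: "ereal ^ 'p ^ 'm" and M :: "(('n::finite, 'm, 'p) vertex \<times> ('n, 'm, 'p) vertex) set"
  shows "sum (edge_cost P) M = feedback_cost P (\<chi> i j. (Input i, Output j) \<in> M)"
proof -
  let ?F = "(\<lambda>(i, j). (Input i, Output j) :: ('n, 'm, 'p) vertex \<times> ('n, 'm, 'p) vertex) `
              {(i, j). (Input i, Output j) \<in> M}"
  have "sum (edge_cost P) M = sum (edge_cost P) ?F"
  proof (rule sum.mono_neutral_right)
    show "\<forall>e\<in>M - ?F. edge_cost P e = 0"
    proof
      fix e assume e: "e \<in> M - ?F"
      obtain a b where ab: "e = (a, b)" by (cases e)
      show "edge_cost P e = 0" using e unfolding ab by (cases a; cases b) auto
    qed
  qed auto
  also have "\<dots> = (\<Sum>(i, j)\<in>{(i, j). (Input i, Output j) \<in> M}. P $ i $ j)"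
    by (subst sum.reindex) (auto simp: inj_on_def intro!: sum.cong)
  finally show ?thesis by (simp add: feedback_cost_def)
qed

theorem theorem2:
  fixes Abar :: "bool ^ 'n ^ 'n"
    and Bbar :: "bool ^ 'm ^ 'n"
    and Cbar :: "bool ^ 'n ^ 'p"
    and P :: "ereal ^ 'p ^ 'm"
    and Cs :: "'n set list"
  assumes nonneg: "\<And>i j. 0 \<le> P $ i $ j"
    and nonempty: "all_star \<in> admissible Abar Bbar Cbar"
    and line: "line_graph (scc_dag (state_digraph Abar)) Cs"
  shows "((\<exists>M. perfect_matching (state_bipartite Abar) M) \<longrightarrow>
            (\<exists>Ka. dp_output Bbar Cbar P Cs Ka) \<and>
            (\<forall>Ka. dp_output Bbar Cbar P Cs Ka \<longrightarrow>
               optimal_solution Abar Bbar Cbar P Ka \<and>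
               feedback_cost P Ka = optimal_cost Abar Bbar Cbar P)) \<and>
         ((\<nexists>M. perfect_matching (state_bipartite Abar) M) \<longrightarrow>
            (\<exists>KA. two_stage_output Abar Bbar Cbar P Cs KA) \<and>
            (\<forall>KA. two_stage_output Abar Bbar Cbar P Cs KA \<longrightarrow>
               KA \<in> admissible Abar Bbar Cbar \<and>
               feedback_cost P KA \<le> 2 * optimal_cost Abar Bbar Cbar P))"
proof -
  let ?Adm = "admissible Abar Bbar Cbar" and ?opt = "optimal_cost Abar Bbar Cbar P"
  let ?cand = "candidate_edges Bbar Cbar Cs"
  let ?edges = "\<lambda>K :: bool ^ 'p ^ 'm. {(j, i). K $ i $ j}"
  have adm: "K \<in> ?Adm \<longleftrightarrow> (\<forall>k \<in> {1..length Cs}. ?edges K \<inter> ?cand k \<noteq> {}) \<and>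
      (\<exists>M. perfect_matching (system_bipartite Abar Bbar Cbar K) M)" for K
    unfolding admissible_def mem_Collect_eq by (rule no_sfms_iff_candidate_cover[OF line])
  have "finite (feedback_cost P ` ?Adm)" by simp
  then have opt_le: "?opt \<le> feedback_cost P K" if "K \<in> ?Adm" for K
    unfolding optimal_cost_def using that by (intro Min_le) auto
  have "?opt \<in> feedback_cost P ` ?Adm"
    unfolding optimal_cost_def using nonempty by (intro Min_in) auto
  then obtain Kopt where Kopt: "Kopt \<in> ?Adm" "feedback_cost P Kopt = ?opt" by auto
  have "?cand k \<noteq> {}" if "k \<in> {1..length Cs}" for k
    using nonempty that unfolding adm by blast
  then obtain W S where "dp_run Bbar Cbar P Cs W S" using dp_run_exists by blast
  then have dp_ex: "\<exists>Ka. dp_output Bbar Cbar P Cs Ka" unfolding dp_output_def by blast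
  have dp: "(\<forall>k \<in> {1..length Cs}. ?edges Ka \<inter> ?cand k \<noteq> {}) \<and> feedback_cost P Ka \<le> ?opt"
    if out: "dp_output Bbar Cbar P Cs Ka" for Ka
  proof -
    obtain W S where run: "dp_run Bbar Cbar P Cs W S" and Ka: "Ka = (\<chi> i j. (j, i) \<in> S (length Cs))"
      using out unfolding dp_output_def by blast
    have edges: "?edges Ka = S (length Cs)" by (auto simp: Ka)
    have "feedback_cost P Ka \<le> W (length Cs)"
      unfolding feedback_cost_edges edges by (rule dp_run_cost_le[OF nonneg run order_refl])
    also have "\<dots> \<le> feedback_cost P Kopt"
      unfolding feedback_cost_edges
      by (rule dp_run_le_cover_cost[OF nonneg run order_refl]) (use Kopt(1) in \<open>simp add: adm\<close>)
    finally show ?thesis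
      unfolding edges Kopt(2) using dp_run_covers[OF run order_refl] by blast
  qed
  have part1: "optimal_solution Abar Bbar Cbar P Ka \<and> feedback_cost P Ka = ?opt"
    if M: "perfect_matching (state_bipartite Abar) M" and out: "dp_output Bbar Cbar P Cs Ka" for M Ka
  proof -
    have Ka: "Ka \<in> ?Adm"
      unfolding adm using dp[OF out] perfect_matching_state_imp_system[OF M] by blast
    then have eq: "feedback_cost P Ka = ?opt" using dp[OF out] opt_le by (simp add: antisym)
    moreover have "optimal_solution Abar Bbar Cbar P Ka"
      unfolding optimal_solution_def is_arg_min_linorder using Ka eq opt_le by simp
    ultimately show ?thesis by blast
  qed
  let ?E = "system_bipartite Abar Bbar Cbar all_star"
  obtain M0 where M0: "perfect_matching ?E M0" using nonempty unfolding adm by blast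
  have "\<exists>M. min_cost_perfect_matching ?E (edge_cost P) M"
    using ex_is_arg_min_if_finite[of "Collect (perfect_matching ?E)" "sum (edge_cost P)"] M0
    unfolding min_cost_perfect_matching_def by auto
  then have two_ex: "\<exists>KA. two_stage_output Abar Bbar Cbar P Cs KA"
    using dp_ex unfolding two_stage_output_def by blast
  have part2: "KA \<in> ?Adm \<and> feedback_cost P KA \<le> 2 * ?opt"
    if out: "two_stage_output Abar Bbar Cbar P Cs KA" for KA
  proof -
    obtain Ka M Kb where Ka: "dp_output Bbar Cbar P Cs Ka"
      and M: "min_cost_perfect_matching ?E (edge_cost P) M"
      and Kb: "Kb = (\<chi> i j. (Input i, Output j) \<in> M)"
      and KA: "KA = (\<chi> i j. Ka $ i $ j \<or> Kb $ i $ j)"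
      using out unfolding two_stage_output_def by blast
    \<comment> \<open>The cover comes from the first stage, the perfect matching from the second.\<close>
    have edges: "?edges KA = ?edges Ka \<union> ?edges Kb" by (auto simp: KA)
    have pm: "perfect_matching ?E M"
      and min: "\<And>M'. perfect_matching ?E M' \<Longrightarrow> sum (edge_cost P) M \<le> sum (edge_cost P) M'"
      using M unfolding min_cost_perfect_matching_def is_arg_min_linorder by auto
    have "M \<subseteq> ?E" using pm by (simp add: perfect_matching_def matching_def)
    then have "M \<subseteq> system_bipartite Abar Bbar Cbar KA"
      by (auto simp: system_bipartite_def KA Kb)
    then have "perfect_matching (system_bipartite Abar Bbar Cbar KA) M"
      using pm by (simp add: perfect_matching_def matching_def)
    then have KA_adm: "KA \<in> ?Adm" unfolding adm edges using dp[OF Ka] by blast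
    obtain M' where M': "perfect_matching (system_bipartite Abar Bbar Cbar Kopt) M'"
      using Kopt(1) unfolding adm by blast
    then have sub: "M' \<subseteq> system_bipartite Abar Bbar Cbar Kopt"
      by (simp add: perfect_matching_def matching_def)
    also have "\<dots> \<subseteq> ?E" by (rule system_bipartite_mono) (simp add: all_star_def)
    finally have "M' \<subseteq> ?E" .
    then have "perfect_matching ?E M'" using M' by (simp add: perfect_matching_def matching_def)
    then have "feedback_cost P Kb \<le> feedback_cost P (\<chi> i j. (Input i, Output j) \<in> M')"
      using min unfolding sum_edge_cost_matching Kb by blast
    \<comment> \<open>The feedback edges of the matching found inside the optimal pattern belong to that pattern.\<close>
    also have "\<dots> \<le> feedback_cost P Kopt"
      unfolding feedback_cost_edges edges_cost_def
      by (rule sum_mono2) (use sub nonneg in \<open>auto simp: system_bipartite_def\<close>)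
    finally have Kb_le: "feedback_cost P Kb \<le> ?opt" by (simp add: Kopt(2))
    have "feedback_cost P KA \<le> feedback_cost P Ka + feedback_cost P Kb"
      unfolding feedback_cost_edges edges by (rule edges_cost_Un_le[OF nonneg])
    also have "\<dots> \<le> ?opt + ?opt" using dp[OF Ka] Kb_le by (intro add_mono) auto
    also have "\<dots> = 2 * ?opt" by (simp add: mult_2_ereal)
    finally show ?thesis using KA_adm by blast
  qed
  show ?thesis using part1 dp_ex part2 two_ex by blast
qed

end
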